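(* Let $\tau\in(2,3)$, $\mu=(\tau-1)/(\tau-2)$ and $\gamma_n=\sqrt{n\mu}$. Let $f:[0,\infty)\to[0,\infty)$ be continuous and nondecreasing with $f(x)/x\to1$ as $x\downarrow0$ and $f(x)\to1$ as $x\to\infty$. Consider the rank-1 inhomogeneous random graph on $n$ vertices with i.i.d. weights having density $\rho(h)=(\tau-1)h^{-\tau}$, $h\ge1$, and connection probability $p(h,h')=f(hh'/\gamma_n^2)$. For every fixed even integer $k\ge4$, the average number $C_k(n)$ of cycles of size $k$ satisfies, as $n\to\infty$, $$C_k(n)\sim\big(\gamma_n^{k(1-\tau)}\log\gamma_n\big)(\tau-1)^k\,\frac1k\binom nk\,k!\int_{-\infty}^\infty|J(v)|^k\,dv,$$ where $$J(v)=\int_0^\infty x^{-2\pi iv-\frac12(\tau+1)}f(x)\,dx,\qquad v\in\mathbb R .$$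
   Context: Model: the graph has $n$ vertices with i.i.d. weights $H_1,\dots,H_n$ with density $\rho$; conditionally on the weights, each pair of vertices $i\ne j$ is connected by an edge independently with probability $p(H_i,H_j)$. The average number of $k$-cycles is $$C_k(n)=\frac1{2k}\binom nk\,k!\int_1^\infty\cdots\int_1^\infty\rho(h_1)\cdots\rho(h_k)\,f\Big(\frac{h_1h_2}{\gamma_n^2}\Big)f\Big(\frac{h_2h_3}{\gamma_n^2}\Big)\cdots f\Big(\frac{h_{k-1}h_k}{\gamma_n^2}\Big)f\Big(\frac{h_kh_1}{\gamma_n^2}\Big)\,dh_1\cdots dh_k .$$ Notation: in the formula for $J$, $i$ is the imaginary unit; $g_1(n)\sim g_2(n)$ means $g_1(n)/g_2(n)\to1$ as $n\to\infty$. *)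

theory Defs
  imports "HOL-Probability.Probability"
begin

text \<open>
  The weight law lives on the half-line itself (not on all reals with density zero below 1), so
  that the connection function is only ever evaluated, and only has to be measurable, at weights
  that are at least 1.
\<close>

definition weight_law :: "real \<Rightarrow> real measure" where
  "weight_law \<tau> =
     density (restrict_space lborel {1..}) (\<lambda>h. ennreal ((\<tau> - 1) * h powr (- \<tau>)))"

text \<open>
  A graph on the vertex set \<open>{1..n}\<close> is represented by its set of edges, an edge being a
  two-element set of vertices. Each unordered pair is enumerated once, as the ordered pair with
  \<open>i < j\<close>; for the symmetric \<open>p\<close> used below the choice of order is immaterial.
\<close>

definition vertex_pairs :: "nat \<Rightarrow> (nat \<times> nat) set" where
  "vertex_pairs n = {(i, j). 1 \<le> i \<and> i < j \<and> j \<le> n}"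

definition graph_given_weights ::
    "(real \<Rightarrow> real \<Rightarrow> real) \<Rightarrow> nat \<Rightarrow> (nat \<Rightarrow> real) \<Rightarrow> nat set set pmf" where
  "graph_given_weights p n h =
     map_pmf (\<lambda>b. {{i, j} | i j. (i, j) \<in> vertex_pairs n \<and> b (i, j)})
       (Pi_pmf (vertex_pairs n) False (\<lambda>(i, j). bernoulli_pmf (p (h i) (h j))))"

definition inhomogeneous_random_graph ::
    "real measure \<Rightarrow> (real \<Rightarrow> real \<Rightarrow> real) \<Rightarrow> nat \<Rightarrow> nat set set measure" where
  "inhomogeneous_random_graph W p n =
     (PiM {1..n} (\<lambda>_. W)) \<bind> (\<lambda>h. measure_pmf (graph_given_weights p n h))"

definition cycle_edges :: "nat list \<Rightarrow> nat set set" where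
  "cycle_edges vs = {{vs ! i, vs ! (Suc i mod length vs)} | i. i < length vs}"

text \<open>
  Cycles are counted as subgraphs, i.e. without a distinguished starting vertex or orientation.
  The definition is meant for \<open>k \<ge> 3\<close>.
\<close>

definition num_cycles :: "nat \<Rightarrow> nat set set \<Rightarrow> nat" where
  "num_cycles k E =
     card {C. C \<subseteq> E \<and> (\<exists>vs. length vs = k \<and> distinct vs \<and> C = cycle_edges vs)}"

definition gamma_scale :: "real \<Rightarrow> nat \<Rightarrow> real" where
  "gamma_scale \<tau> n = sqrt (real n * ((\<tau> - 1) / (\<tau> - 2)))"

definition connection_prob :: "real \<Rightarrow> (real \<Rightarrow> real) \<Rightarrow> nat \<Rightarrow> real \<Rightarrow> real \<Rightarrow> real" where
  "connection_prob \<tau> f n h h' = f (h * h' / (gamma_scale \<tau> n)\<^sup>2)"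

definition mean_cycles :: "real \<Rightarrow> (real \<Rightarrow> real) \<Rightarrow> nat \<Rightarrow> nat \<Rightarrow> real" where
  "mean_cycles \<tau> f k n =
     (\<integral>E. real (num_cycles k E)
        \<partial>inhomogeneous_random_graph (weight_law \<tau>) (connection_prob \<tau> f n) n)"

definition J_integral :: "real \<Rightarrow> (real \<Rightarrow> real) \<Rightarrow> real \<Rightarrow> complex" where
  "J_integral \<tau> f v =
     (LBINT x:{0<..}.
        complex_of_real x powr (- 2 * complex_of_real pi * \<i> * complex_of_real v
                                - complex_of_real ((\<tau> + 1) / 2))
        * complex_of_real (f x))"

end

theory Submission
  imports Defs "HOL-Number_Theory.Cong"
begin

text \<open>
  With \<open>h\<^sub>i = \<gamma>\<^sub>n exp u\<^sub>i\<close> and \<open>L = ln \<gamma>\<^sub>n\<close>, the probability that a given \<open>k\<close>-cycle is present becomes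
  \<open>((\<tau> - 1) \<gamma>\<^sub>n powr (1 - \<tau>)) ^ k\<close> times the integral of the cyclic product of the \<open>g (u\<^sub>i + u\<^sub>i\<^sub>+\<^sub>1)\<close> over
  all \<open>u\<^sub>i \<ge> - L\<close>, where \<open>g s = exp (s (1 - \<tau>) / 2) f (exp s)\<close> decays exponentially in both directions.
  For even \<open>k\<close> the product is invariant under \<open>u\<^sub>i \<mapsto> u\<^sub>i + (- 1)\<^sup>i t\<close>, and the constraint confines \<open>t\<close> to an
  interval of length \<open>2 L + O(1)\<close>. Dominated convergence therefore gives \<open>2 L\<close> times the integral
  transverse to this shift, which is a \<open>k\<close>-fold convolution of alternating reflections of \<open>g\<close>, evaluated
  at \<open>0\<close>. As \<open>J\<close> is the Fourier transform of \<open>g\<close>, Fourier inversion turns it into the integral of \<open>|J|^k\<close>.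
\<close>

section \<open>Change of variables in product integrals\<close>

text \<open>The factor \<open>1 / k\<close>, rather than \<open>1 / (2 * k)\<close>, arises because
  each cycle has \<open>2 * k\<close> vertex lists while the shift interval contributes
  \<open>2 * L\<close>. The cut-off bounds \<open>t\<close> from below near \<open>- L\<close> at
  even positions and from above near \<open>L\<close> at odd ones. An odd cycle has no such
  direction, since alternating signs do not close up. The condition \<open>\<tau> < 3\<close> makes
  \<open>g\<close> integrable: the linear bound on \<open>f\<close> gives decay rate
  \<open>(3 - \<tau>) / 2\<close> at minus infinity, and the bound \<open>f \<le> 1\<close> gives
  \<open>(\<tau> - 1) / 2\<close> at plus infinity. Exponential decay also supplies the first moment
  that dominates the fluctuation of the interval length. Two obstacles shape the details. Asymptotic
  equivalence requires a nonzero limit constant, hence the strict positivity of the iterated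
  convolutions. And \<open>f\<close> is controlled on nonnegative arguments only, so measurability
  always goes through \<open>f (max 0 x)\<close> or through the weight space itself. Nonnegative
  integrals are used up to the end of the probabilistic part, so that the order of integration can
  be exchanged before anything is known to be finite.\<close>

text \<open>The assumption \<open>subst\<close> says that \<open>M i\<close> is the image under
  \<open>\<phi> i\<close> of the measure with density \<open>r i\<close> on \<open>N i\<close>.
  Formulated through integrals, it applies directly to the inner integral when the coordinates are
  peeled off one by one.\<close>

lemma nn_integral_PiM_substitution:
  fixes M :: "'i \<Rightarrow> 'a measure" and N :: "'i \<Rightarrow> 'b measure"
  assumes "product_sigma_finite M" "product_sigma_finite N"
  assumes \<phi>[measurable]: "\<And>i. \<phi> i \<in> measurable (N i) (M i)"
    and r[measurable]: "\<And>i. r i \<in> borel_measurable (N i)"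
    and subst: "\<And>i F. F \<in> borel_measurable (M i) \<Longrightarrow>
      (\<integral>\<^sup>+x. F x \<partial>M i) = (\<integral>\<^sup>+u. F (\<phi> i u) * r i u \<partial>N i)"
    and "finite I" and "F \<in> borel_measurable (PiM I M)"
  shows "(\<integral>\<^sup>+x. F x \<partial>PiM I M)
       = (\<integral>\<^sup>+u. F (\<lambda>i\<in>I. \<phi> i (u i)) * (\<Prod>i\<in>I. r i (u i)) \<partial>PiM I N)"
proof -
  interpret M: product_sigma_finite M by fact
  interpret N: product_sigma_finite N by fact
  show ?thesis
    using \<open>finite I\<close> \<open>F \<in> borel_measurable (PiM I M)\<close>
  proof (induction I arbitrary: F rule: finite_induct)
    case empty
    have "(\<lambda>i\<in>{}. \<phi> i (u i)) = (\<lambda>_. undefined)" for u :: "'i \<Rightarrow> 'b"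
      by auto
    then show ?case
      by (simp add: PiM_empty nn_integral_count_space_finite)
  next
    case (insert j I)
    note [measurable] = insert.prems
    note [simp] = insert.hyps
    interpret MI: sigma_finite_measure "PiM I M" by (rule M.sigma_finite) simp
    interpret NI: sigma_finite_measure "PiM I N" by (rule N.sigma_finite) simp
    have *: "(\<integral>\<^sup>+x. F (x(j := y)) \<partial>PiM I M)
        = (\<integral>\<^sup>+u. F ((\<lambda>i\<in>I. \<phi> i (u i))(j := y)) * (\<Prod>i\<in>I. r i (u i)) \<partial>PiM I N)"
      if "y \<in> space (M j)" for y
    proof (rule insert.IH)
      show "(\<lambda>x. F (x(j := y))) \<in> borel_measurable (PiM I M)"
        using that by (intro measurable_compose[OF _ insert.prems] measurable_fun_upd[where J=I]) auto
    qed
    have ext: "(\<lambda>i\<in>I. \<phi> i (u i))(j := \<phi> j y) = (\<lambda>i\<in>insert j I. \<phi> i ((u(j := y)) i))" for u y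
      by (auto simp: fun_eq_iff)
    have prd: "(\<Prod>i\<in>I. r i (u i)) * r j y = (\<Prod>i\<in>insert j I. r i ((u(j := y)) i))" for u y
      by (auto simp: mult.commute intro!: arg_cong2[where f="(*)"] prod.cong)
    \<comment> \<open>The inner integral, as a function of the remaining coordinate, has to be
      measurable before \<open>subst\<close> may be applied to it.\<close>
    have G[measurable]: "(\<lambda>y. \<integral>\<^sup>+u. F ((\<lambda>i\<in>I. \<phi> i (u i))(j := y)) * (\<Prod>i\<in>I. r i (u i)) \<partial>PiM I N)
        \<in> borel_measurable (M j)"
    proof (rule NI.borel_measurable_nn_integral)
      have "(\<lambda>z. (\<lambda>i\<in>I. \<phi> i (snd z i))(j := fst z)) \<in> measurable (M j \<Otimes>\<^sub>M PiM I N) (PiM (insert j I) M)"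
        by (rule measurable_fun_upd[where J=I]) auto
      from measurable_compose[OF this insert.prems]
      have 1: "(\<lambda>z. F ((\<lambda>i\<in>I. \<phi> i (snd z i))(j := fst z))) \<in> borel_measurable (M j \<Otimes>\<^sub>M PiM I N)" .
      have 2: "(\<lambda>z. \<Prod>i\<in>I. r i (snd z i)) \<in> borel_measurable (M j \<Otimes>\<^sub>M PiM I N)"
        by measurable
      show "(\<lambda>(y, u). F ((\<lambda>i\<in>I. \<phi> i (u i))(j := y)) * (\<Prod>i\<in>I. r i (u i)))
        \<in> borel_measurable (M j \<Otimes>\<^sub>M PiM I N)"
        unfolding split_beta' using 1 2 by (rule borel_measurable_times_ennreal)
    qed
    have H: "(\<lambda>u. F (\<lambda>i\<in>insert j I. \<phi> i (u i)) * (\<Prod>i\<in>insert j I. r i (u i)))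
       \<in> borel_measurable (PiM (insert j I) N)"
      by measurable
    have "(\<integral>\<^sup>+x. F x \<partial>PiM (insert j I) M) = (\<integral>\<^sup>+y. \<integral>\<^sup>+x. F (x(j := y)) \<partial>PiM I M \<partial>M j)"
      by (rule M.product_nn_integral_insert_rev) auto
    also have "\<dots> = (\<integral>\<^sup>+y. \<integral>\<^sup>+u. F ((\<lambda>i\<in>I. \<phi> i (u i))(j := y)) * (\<Prod>i\<in>I. r i (u i)) \<partial>PiM I N \<partial>M j)"
      by (intro nn_integral_cong *)
    also have "\<dots> = (\<integral>\<^sup>+y. (\<integral>\<^sup>+u. F ((\<lambda>i\<in>I. \<phi> i (u i))(j := \<phi> j y)) * (\<Prod>i\<in>I. r i (u i)) \<partial>PiM I N) * r j y \<partial>N j)"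
      by (rule subst) (rule G)
    also have "\<dots> = (\<integral>\<^sup>+y. (\<integral>\<^sup>+u. F ((\<lambda>i\<in>I. \<phi> i (u i))(j := \<phi> j y)) * (\<Prod>i\<in>I. r i (u i)) * r j y \<partial>PiM I N) \<partial>N j)"
    proof (intro nn_integral_cong nn_integral_multc[symmetric])
      fix y assume y: "y \<in> space (N j)"
      have "(\<lambda>u. (\<lambda>i\<in>I. \<phi> i (u i))(j := \<phi> j y)) \<in> measurable (PiM I N) (PiM (insert j I) M)"
        using measurable_space[OF \<phi> y] by (intro measurable_fun_upd[where J=I]) auto
      from measurable_compose[OF this insert.prems]
      have 1: "(\<lambda>u. F ((\<lambda>i\<in>I. \<phi> i (u i))(j := \<phi> j y))) \<in> borel_measurable (PiM I N)" .
      have 2: "(\<lambda>u. \<Prod>i\<in>I. r i (u i)) \<in> borel_measurable (PiM I N)"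
        by measurable
      show "(\<lambda>u. F ((\<lambda>i\<in>I. \<phi> i (u i))(j := \<phi> j y)) * (\<Prod>i\<in>I. r i (u i))) \<in> borel_measurable (PiM I N)"
        using 1 2 by (rule borel_measurable_times_ennreal)
    qed
    also have "\<dots> = (\<integral>\<^sup>+y. (\<integral>\<^sup>+u. F (\<lambda>i\<in>insert j I. \<phi> i ((u(j := y)) i)) *
        (\<Prod>i\<in>insert j I. r i ((u(j := y)) i)) \<partial>PiM I N) \<partial>N j)"
      unfolding ext mult.assoc prd ..
    also have "\<dots> = (\<integral>\<^sup>+u. F (\<lambda>i\<in>insert j I. \<phi> i (u i)) * (\<Prod>i\<in>insert j I. r i (u i)) \<partial>PiM (insert j I) N)"
      by (rule N.product_nn_integral_insert_rev[symmetric]) (auto intro: H)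
    finally show ?case .
  qed
qed

lemma nn_integral_PiM_lborel_translate:
  fixes F :: "('i \<Rightarrow> real) \<Rightarrow> ennreal"
  assumes "finite I" "F \<in> borel_measurable (PiM I (\<lambda>_. lborel))"
  shows "(\<integral>\<^sup>+u. F u \<partial>PiM I (\<lambda>_. lborel)) = (\<integral>\<^sup>+s. F (\<lambda>i\<in>I. c i + s i) \<partial>PiM I (\<lambda>_. lborel))"
proof -
  have psf: "product_sigma_finite (\<lambda>_::'i. lborel :: real measure)"
    by (simp add: product_sigma_finite_def lborel.sigma_finite_measure_axioms)
  have "(\<integral>\<^sup>+x. G x \<partial>lborel) = (\<integral>\<^sup>+u. G (c i + u) * 1 \<partial>lborel)"
    if "G \<in> borel_measurable lborel" for i and G :: "real \<Rightarrow> ennreal"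
  proof -
    have "G \<in> borel_measurable borel" using that by simp
    from nn_integral_real_affine[OF this, of 1 "c i"] show ?thesis by simp
  qed
  then have "(\<integral>\<^sup>+u. F u \<partial>PiM I (\<lambda>_. lborel)) =
      (\<integral>\<^sup>+s. F (\<lambda>i\<in>I. c i + s i) * (\<Prod>i\<in>I. 1) \<partial>PiM I (\<lambda>_. lborel))"
    using psf assms
    by (intro nn_integral_PiM_substitution[where \<phi>="\<lambda>i u. c i + u" and r="\<lambda>_ _. 1"]) simp_all
  also have "\<dots> = (\<integral>\<^sup>+s. F (\<lambda>i\<in>I. c i + s i) \<partial>PiM I (\<lambda>_. lborel))"
    by simp
  finally show ?thesis .
qed

section \<open>Exponential substitution on the positive half-line\<close>

text \<open>As an identity of measures the substitution \<open>x = exp s\<close> serves both the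
  nonnegative integrals over weights and the complex integral defining \<open>J_integral\<close>.
  Substitution on compact intervals is extended by monotone convergence along
  \<open>{exp (- n)..exp n}\<close>.\<close>

lemma density_indicator_eq_distr_exp:
  "density lborel (indicator {0<..}) = distr (density lborel (\<lambda>s. ennreal (exp s))) lborel exp"
proof -
  have "(\<integral>\<^sup>+x. indicator A x * indicator {0<..} x \<partial>lborel) =
      (\<integral>\<^sup>+s. indicator A (exp s) * ennreal (exp s) \<partial>lborel)"
    if [measurable]: "A \<in> sets borel" for A :: "real set"
  proof -
    have 1: "(\<integral>\<^sup>+x. indicator A x * indicator {exp (-real n)..exp (real n)} x \<partial>lborel) =
      (\<integral>\<^sup>+s. indicator A (exp s) * ennreal (exp s) * indicator {-real n..real n} s \<partial>lborel)" for n
    proof -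
      have "(\<integral>\<^sup>+x. ennreal (indicator A x * indicator {exp (-real n)..exp (real n)} x) \<partial>lborel) =
      (\<integral>\<^sup>+s. ennreal (indicator A (exp s) * exp s * indicator {-real n..real n} s) \<partial>lborel)"
        by (rule nn_integral_substitution[where g=exp and g'=exp]) (auto intro!: derivative_eq_intros continuous_intros simp: set_borel_measurable_def)
      then show ?thesis by (simp add: ennreal_mult ennreal_indicator)
    qed
    have sup1: "(SUP n. indicator A x * indicator {exp (-real n)..exp (real n)} x) = (indicator A x * indicator {0<..} x :: ennreal)"
      for x :: real
    proof (cases "x > 0 \<and> x \<in> A")
      case True
      obtain n where n: "\<bar>ln x\<bar> \<le> real n" using real_arch_simple by blast
      have "x = exp (ln x)" using True by simp
      then have "x \<in> {exp (-real n)..exp (real n)}"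
        using n by (metis abs_le_iff atLeastAtMost_iff exp_le_cancel_iff minus_le_iff)
      then show ?thesis using True by (intro antisym SUP_least SUP_upper2[where i=n]) (auto simp: indicator_def)
    next
      case False
      have "\<not> (exp (- real n) \<le> x)" if "x \<le> 0" for n
        using that exp_gt_zero[of "- real n"] by linarith
      with False show ?thesis by (auto simp: indicator_def not_less)
    qed
    have sup2: "(SUP n. indicator A (exp s) * ennreal (exp s) * indicator {-real n..real n} s) = indicator A (exp s) * ennreal (exp s)"
      for s :: real
    proof -
      obtain n where n: "\<bar>s\<bar> \<le> real n" using real_arch_simple by blast
      then show ?thesis by (intro antisym SUP_least SUP_upper2[where i=n]) (auto simp: indicator_def)
    qed
    have "(\<integral>\<^sup>+x. indicator A x * indicator {0<..} x \<partial>lborel) =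
        (SUP n. \<integral>\<^sup>+x. indicator A x * indicator {exp (-real n)..exp (real n)} x \<partial>lborel)"
      unfolding sup1[symmetric]
    proof (rule nn_integral_monotone_convergence_SUP)
      show "incseq (\<lambda>n x. indicator A x * indicator {exp (-real n)..exp (real n)} x :: ennreal)"
        by (auto simp: incseq_def le_fun_def indicator_def intro: order_trans[of "exp (- real _)" "exp (- real _)"] order_trans[of _ "exp (real _)" "exp (real _)"])
    qed auto
    also have "\<dots> = (SUP n. \<integral>\<^sup>+s. indicator A (exp s) * ennreal (exp s) * indicator {-real n..real n} s \<partial>lborel)"
      unfolding 1 ..
    also have "\<dots> = (\<integral>\<^sup>+s. (SUP n. indicator A (exp s) * ennreal (exp s) * indicator {-real n..real n} s) \<partial>lborel)"
    proof (rule nn_integral_monotone_convergence_SUP[symmetric])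
      show "incseq (\<lambda>n s. indicator A (exp s) * ennreal (exp s) * indicator {-real n..real n} s)"
        by (auto simp: incseq_def le_fun_def indicator_def)
    qed auto
    also have "\<dots> = (\<integral>\<^sup>+s. indicator A (exp s) * ennreal (exp s) \<partial>lborel)"
      unfolding sup2 ..
    finally show ?thesis .
  qed
  note ind = this
  show ?thesis
  proof (rule measure_eqI)
    fix A :: "real set" assume "A \<in> sets (density lborel (indicator {0<..}))"
    then have [measurable]: "A \<in> sets borel" by simp
    have [measurable]: "exp -` A \<in> sets (borel :: real measure)"
      using measurable_sets_borel[of "exp :: real \<Rightarrow> real" borel A] by simp
    have "emeasure (distr (density lborel (\<lambda>s. ennreal (exp s))) lborel exp) A
        = (\<integral>\<^sup>+s. indicator A (exp s) * ennreal (exp s) \<partial>lborel)"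
      by (subst emeasure_distr)
        (auto simp: emeasure_density indicator_def mult.commute intro!: nn_integral_cong)
    then show "emeasure (density lborel (indicator {0<..})) A = emeasure (distr (density lborel (\<lambda>s. ennreal (exp s))) lborel exp) A"
      using ind[of A] by (simp add: emeasure_density mult.commute)
  qed simp
qed

lemma nn_integral_exp_substitution:
  fixes F :: "real \<Rightarrow> ennreal"
  assumes F[measurable]: "F \<in> borel_measurable borel"
  shows "(\<integral>\<^sup>+x. F x * indicator {0<..} x \<partial>lborel) = (\<integral>\<^sup>+s. F (exp s) * ennreal (exp s) \<partial>lborel)"
proof -
  have "(\<integral>\<^sup>+x. F x * indicator {0<..} x \<partial>lborel) = (\<integral>\<^sup>+x. F x \<partial>density lborel (indicator {0<..}))"
    by (simp add: nn_integral_density mult.commute)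
  also have "\<dots> = (\<integral>\<^sup>+s. F (exp s) * ennreal (exp s) \<partial>lborel)"
    unfolding density_indicator_eq_distr_exp by (simp add: nn_integral_density nn_integral_distr mult.commute)
  finally show ?thesis .
qed

section \<open>Cycle weights in logarithmic coordinates\<close>

lemma bij_betw_Suc_mod:
  assumes "0 < k"
  shows "bij_betw (\<lambda>i. Suc i mod k) {..<k} {..<k}"
proof -
  have "inj_on (\<lambda>i. Suc i mod k) {..<k}"
    by (rule inj_onI) (auto simp: mod_Suc split: if_splits)
  moreover have "(\<lambda>i. Suc i mod k) ` {..<k} = {..<k}"
    using assms calculation by (intro endo_inj_surj) auto
  ultimately show ?thesis
    by (simp add: bij_betw_def)
qed

lemma sets_weight_law [measurable_cong]: "sets (weight_law \<tau>) = sets (restrict_space borel {1..})"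
  by (simp add: weight_law_def sets_restrict_space)

lemma space_weight_law [simp]: "space (weight_law \<tau>) = {1..}"
  by (simp add: weight_law_def space_restrict_space)

text \<open>
  Truncating \<open>\<gamma> exp u\<close> at \<open>1\<close> keeps the substitution inside the space of the weight law; it acts only
  where the indicator vanishes.
\<close>

lemma nn_integral_weight_law:
  assumes "1 < \<tau>" "0 < \<gamma>" and F: "F \<in> borel_measurable (weight_law \<tau>)"
  shows "(\<integral>\<^sup>+h. F h \<partial>weight_law \<tau>) = (\<integral>\<^sup>+u. F (max 1 (\<gamma> * exp u)) *
      (ennreal ((\<tau> - 1) * \<gamma> powr (1 - \<tau>) * exp ((1 - \<tau>) * u)) * indicator {- ln \<gamma>..} u) \<partial>lborel)"
proof -
  define d where "d h = ennreal ((\<tau> - 1) * h powr (- \<tau>))" for h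
  have d[measurable]: "d \<in> borel_measurable borel" unfolding d_def by measurable
  have F': "F \<in> borel_measurable (restrict_space lborel {1..})"
    using F by (simp add: weight_law_def)
  \<comment> \<open>\<open>F\<close> is measurable on the half-line only; its product with the
    indicator is Borel on the whole line, and the calculation on \<open>lborel\<close> works with
    that product.\<close>
  have F1[measurable]: "(\<lambda>h. F h * indicator {1..} h) \<in> borel_measurable borel"
    using F' by (subst (asm) borel_measurable_restrict_space_iff_ennreal) auto
  have d': "d \<in> borel_measurable (restrict_space lborel {1..})"
    by (rule measurable_restrict_space1) simp
  have "(\<integral>\<^sup>+h. F h \<partial>weight_law \<tau>) = (\<integral>\<^sup>+h. d h * F h \<partial>restrict_space lborel {1..})"
    unfolding weight_law_def d_def[symmetric] by (rule nn_integral_density[OF d' F'])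
  also have "\<dots> = (\<integral>\<^sup>+h. d h * F h * indicator {1..} h \<partial>lborel)"
    by (subst nn_integral_restrict_space) auto
  also have "\<dots> = (\<integral>\<^sup>+h. (d h * (F h * indicator {1..} h)) * indicator {0<..} h \<partial>lborel)"
    by (intro nn_integral_cong) (auto simp: indicator_def)
  also have "\<dots> = (\<integral>\<^sup>+s. (d (exp s) * (F (exp s) * indicator {1..} (exp s))) * ennreal (exp s) \<partial>lborel)"
    by (rule nn_integral_exp_substitution) measurable
  also have "\<dots> = (\<integral>\<^sup>+u. (d (exp (ln \<gamma> + u)) * (F (exp (ln \<gamma> + u)) * indicator {1..} (exp (ln \<gamma> + u))))
      * ennreal (exp (ln \<gamma> + u)) \<partial>lborel)"
  proof -
    have "(\<lambda>s. (d (exp s) * (F (exp s) * indicator {1..} (exp s))) * ennreal (exp s)) \<in> borel_measurable borel"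
      using measurable_compose[OF _ F1, of exp borel] by measurable
    from nn_integral_real_affine[OF this, of 1 "ln \<gamma>"] show ?thesis by simp
  qed
  also have "\<dots> = (\<integral>\<^sup>+u. F (max 1 (\<gamma> * exp u)) *
      (ennreal ((\<tau> - 1) * \<gamma> powr (1 - \<tau>) * exp ((1 - \<tau>) * u)) * indicator {- ln \<gamma>..} u) \<partial>lborel)"
  proof (intro nn_integral_cong)
    fix u :: real
    have e: "exp (ln \<gamma> + u) = \<gamma> * exp u" using assms by (simp add: exp_add)
    have i: "\<gamma> * exp u \<ge> 1 \<longleftrightarrow> u \<ge> - ln \<gamma>"
      unfolding e[symmetric] by (simp add: one_le_exp_iff) linarith
    show "(d (exp (ln \<gamma> + u)) * (F (exp (ln \<gamma> + u)) * indicator {1..} (exp (ln \<gamma> + u))))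
      * ennreal (exp (ln \<gamma> + u)) = F (max 1 (\<gamma> * exp u)) *
      (ennreal ((\<tau> - 1) * \<gamma> powr (1 - \<tau>) * exp ((1 - \<tau>) * u)) * indicator {- ln \<gamma>..} u)"
    proof (cases "u \<ge> - ln \<gamma>")
      case True
      have "(\<gamma> * exp u) powr (- \<tau>) * (\<gamma> * exp u) = (\<gamma> * exp u) powr (1 - \<tau>)"
        using assms by (simp add: powr_diff powr_minus divide_simps)
      also have "\<dots> = \<gamma> powr (1 - \<tau>) * exp ((1 - \<tau>) * u)"
        using assms by (simp add: powr_mult exp_powr_real mult.commute)
      finally have d: "d (\<gamma> * exp u) * ennreal (\<gamma> * exp u)
          = ennreal ((\<tau> - 1) * \<gamma> powr (1 - \<tau>) * exp ((1 - \<tau>) * u))"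
        using assms unfolding d_def by (simp add: ennreal_mult[symmetric] mult.assoc)
      have "(d (exp (ln \<gamma> + u)) * (F (exp (ln \<gamma> + u)) * indicator {1..} (exp (ln \<gamma> + u))))
          * ennreal (exp (ln \<gamma> + u)) = F (\<gamma> * exp u) * (d (\<gamma> * exp u) * ennreal (\<gamma> * exp u))"
        using True i by (simp add: e mult_ac)
      then show ?thesis
        unfolding d using True i by (simp add: max_def)
    next
      case False
      then show ?thesis using i by (simp add: e)
    qed
  qed
  finally show ?thesis .
qed

text \<open>At scale \<open>\<gamma> = 1\<close> the logarithm of a weight is exponentially
  distributed with rate \<open>\<tau> - 1\<close>, which gives total mass 1.\<close>

lemma prob_space_weight_law:
  assumes "1 < \<tau>"
  shows "prob_space (weight_law \<tau>)"
proof
  have "emeasure (weight_law \<tau>) (space (weight_law \<tau>)) = (\<integral>\<^sup>+h. 1 \<partial>weight_law \<tau>)"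
    by simp
  also have "\<dots> = (\<integral>\<^sup>+u. exponential_density (\<tau> - 1) u \<partial>lborel)"
    unfolding nn_integral_weight_law[where \<gamma>=1, OF assms zero_less_one borel_measurable_const]
    by (intro nn_integral_cong)
      (auto simp: exponential_density_def indicator_def algebra_simps ennreal_mult)
  also have "\<dots> = 1"
    using prob_space.emeasure_space_1[OF prob_space_exponential_density[of "\<tau> - 1"]] assms
    by (simp add: emeasure_density)
  finally show "emeasure (weight_law \<tau>) (space (weight_law \<tau>)) = 1" .
qed

text \<open>The vertex factor \<open>exp ((1 - \<tau>) * u)\<close> is shared equally by the two
  cycle edges at that vertex; this is the origin of the exponent
  \<open>(1 - \<tau>) / 2\<close>.\<close>

definition log_kernel :: "real \<Rightarrow> (real \<Rightarrow> real) \<Rightarrow> real \<Rightarrow> real" where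
  "log_kernel \<tau> f s = exp (s * (1 - \<tau>) / 2) * f (exp s)"

lemma nn_integral_cycle_weights:
  assumes "1 < \<tau>" "0 < \<gamma>" "0 < k"
    and f: "(\<lambda>x. f (max 0 x)) \<in> borel_measurable borel"
    and nonneg: "\<And>x. 0 \<le> x \<Longrightarrow> 0 \<le> f x"
  shows "(\<integral>\<^sup>+h. (\<Prod>i<k. ennreal (f (h i * h (Suc i mod k) / \<gamma>\<^sup>2))) \<partial>PiM {..<k} (\<lambda>_. weight_law \<tau>))
    = ennreal (((\<tau> - 1) * \<gamma> powr (1 - \<tau>)) ^ k) *
      (\<integral>\<^sup>+u. (\<Prod>i<k. ennreal (log_kernel \<tau> f (u i + u (Suc i mod k)))) * (\<Prod>i<k. indicator {- ln \<gamma>..} (u i))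
        \<partial>PiM {..<k} (\<lambda>_. lborel))"
proof -
  interpret W: prob_space "weight_law \<tau>" by (rule prob_space_weight_law) fact
  have psW: "product_sigma_finite (\<lambda>_::nat. weight_law \<tau>)"
    by (simp add: product_sigma_finite_def W.sigma_finite_measure_axioms)
  have psl: "product_sigma_finite (\<lambda>_::nat. lborel :: real measure)"
    by (simp add: product_sigma_finite_def lborel.sigma_finite_measure_axioms)
  \<comment> \<open>Nothing is known about \<open>f\<close> at negative arguments, so the measurable
    function is its extension by the constant \<open>f 0\<close>. On the product of weight laws all
    arguments are positive and the two agree.\<close>
  define f0 where "f0 x = f (max 0 x)" for x
  have f0[measurable]: "f0 \<in> borel_measurable borel" using f unfolding f0_def .
  define c where "c = (\<tau> - 1) * \<gamma> powr (1 - \<tau>)"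
  have c: "c \<ge> 0" using assms by (simp add: c_def)
  define F where "F h = (\<Prod>i<k. ennreal (f0 (h i * h (Suc i mod k) / \<gamma>\<^sup>2)))" for h :: "nat \<Rightarrow> real"
  define r where "r u = ennreal (c * exp ((1 - \<tau>) * u)) * indicator {- ln \<gamma>..} u" for u
  have r[measurable]: "r \<in> borel_measurable borel" unfolding r_def by measurable
  have id_meas: "(\<lambda>x. x) \<in> weight_law \<tau> \<rightarrow>\<^sub>M borel"
    unfolding measurable_cong_sets[OF sets_weight_law refl] by (simp add: measurable_restrict_space1)
  have comp: "(\<lambda>h. h i) \<in> borel_measurable (PiM {..<k} (\<lambda>_. weight_law \<tau>))" if "i < k" for i
    using measurable_compose[OF measurable_component_singleton[of i "{..<k}" "\<lambda>_. weight_law \<tau>"] id_meas] that by simp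
  have F[measurable]: "F \<in> borel_measurable (PiM {..<k} (\<lambda>_. weight_law \<tau>))"
    unfolding F_def using \<open>0 < k\<close>
    by (intro borel_measurable_prod_ennreal measurable_compose[OF _ measurable_ennreal]
        measurable_compose[OF _ f0] borel_measurable_divide borel_measurable_times comp) auto
  have max_meas: "(\<lambda>u. max 1 (\<gamma> * exp u)) \<in> lborel \<rightarrow>\<^sub>M weight_law \<tau>"
    unfolding measurable_cong_sets[OF refl sets_weight_law] by (auto intro!: measurable_restrict_space2)
  have "(\<integral>\<^sup>+h. (\<Prod>i<k. ennreal (f (h i * h (Suc i mod k) / \<gamma>\<^sup>2))) \<partial>PiM {..<k} (\<lambda>_. weight_law \<tau>))
     = (\<integral>\<^sup>+h. F h \<partial>PiM {..<k} (\<lambda>_. weight_law \<tau>))"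
  proof (rule nn_integral_cong)
    fix h assume "h \<in> space (PiM {..<k} (\<lambda>_. weight_law \<tau>))"
    then have "1 \<le> h i" if "i < k" for i using that by (auto simp: space_PiM PiE_iff)
    then have "0 \<le> h i" if "i < k" for i using that by (meson order_trans zero_le_one)
    then show "(\<Prod>i<k. ennreal (f (h i * h (Suc i mod k) / \<gamma>\<^sup>2))) = F h"
      using \<open>0 < k\<close> unfolding F_def f0_def by (intro prod.cong) (auto simp: max_def)
  qed
  also have "\<dots> = (\<integral>\<^sup>+u. F (\<lambda>i\<in>{..<k}. max 1 (\<gamma> * exp (u i))) * (\<Prod>i<k. r (u i)) \<partial>PiM {..<k} (\<lambda>_. lborel))"
  proof (rule nn_integral_PiM_substitution[OF psW psl])
    show "integral\<^sup>N (weight_law \<tau>) G = (\<integral>\<^sup>+u. G (max 1 (\<gamma> * exp u)) * r u \<partial>lborel)"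
      if "G \<in> borel_measurable (weight_law \<tau>)" for G
      unfolding r_def c_def by (rule nn_integral_weight_law[OF assms(1,2) that])
  qed (use max_meas in auto)
  also have "\<dots> = (\<integral>\<^sup>+u. ennreal (c ^ k) * ((\<Prod>i<k. ennreal (log_kernel \<tau> f (u i + u (Suc i mod k)))) *
      (\<Prod>i<k. indicator {- ln \<gamma>..} (u i))) \<partial>PiM {..<k} (\<lambda>_. lborel))"
  proof (rule nn_integral_cong)
    fix u :: "nat \<Rightarrow> real"
    show "F (\<lambda>i\<in>{..<k}. max 1 (\<gamma> * exp (u i))) * (\<Prod>i<k. r (u i)) =
      ennreal (c ^ k) * ((\<Prod>i<k. ennreal (log_kernel \<tau> f (u i + u (Suc i mod k)))) * (\<Prod>i<k. indicator {- ln \<gamma>..} (u i)))"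
    proof (cases "\<forall>i<k. - ln \<gamma> \<le> u i")
      case True
      have 1: "max 1 (\<gamma> * exp (u i)) = \<gamma> * exp (u i)" if "i < k" for i
      proof -
        have "0 \<le> ln \<gamma> + u i" using True that by force
        then have "1 \<le> exp (ln \<gamma> + u i)" by simp
        then show ?thesis using assms by (simp add: exp_add)
      qed
      have "F (\<lambda>i\<in>{..<k}. max 1 (\<gamma> * exp (u i))) = (\<Prod>i<k. ennreal (f (exp (u i + u (Suc i mod k)))))"
        unfolding F_def
      proof (rule prod.cong)
        fix i assume "i \<in> {..<k}"
        then have "i < k" "Suc i mod k < k" using \<open>0 < k\<close> by auto
        then have "(\<lambda>i\<in>{..<k}. max 1 (\<gamma> * exp (u i))) i * (\<lambda>i\<in>{..<k}. max 1 (\<gamma> * exp (u i))) (Suc i mod k) / \<gamma>\<^sup>2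
            = exp (u i + u (Suc i mod k))"
          using assms by (simp add: 1 power2_eq_square exp_add)
        then show "ennreal (f0 ((\<lambda>i\<in>{..<k}. max 1 (\<gamma> * exp (u i))) i * (\<lambda>i\<in>{..<k}. max 1 (\<gamma> * exp (u i))) (Suc i mod k) / \<gamma>\<^sup>2))
            = ennreal (f (exp (u i + u (Suc i mod k))))"
          unfolding f0_def by (simp only:) (simp add: max_def)
      qed simp
      also have "\<dots> * (\<Prod>i<k. r (u i)) = ennreal ((\<Prod>i<k. f (exp (u i + u (Suc i mod k)))) * (\<Prod>i<k. c * exp ((1 - \<tau>) * u i)))"
      proof -
        have "(\<Prod>i<k. r (u i)) = ennreal (\<Prod>i<k. c * exp ((1 - \<tau>) * u i))"
          using True c by (subst prod_ennreal[symmetric]) (auto simp: r_def)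
        moreover have "(\<Prod>i<k. ennreal (f (exp (u i + u (Suc i mod k))))) =
            ennreal (\<Prod>i<k. f (exp (u i + u (Suc i mod k))))"
          using nonneg by (intro prod_ennreal) auto
        ultimately show ?thesis using nonneg c by (simp only: ennreal_mult prod_nonneg exp_ge_zero mult_nonneg_nonneg)
      qed
      also have "(\<Prod>i<k. c * exp ((1 - \<tau>) * u i)) = c ^ k * (\<Prod>i<k. exp ((u i + u (Suc i mod k)) * (1 - \<tau>) / 2))"
      proof -
        \<comment> \<open>Each vertex factor is split into two equal halves. Rotating the index in
          the second product by one hands one half to each edge at the vertex.\<close>
        have "(\<Prod>i<k. exp ((1 - \<tau>) * u i)) = (\<Prod>i<k. exp ((1 - \<tau>) / 2 * u i)) * (\<Prod>i<k. exp ((1 - \<tau>) / 2 * u i))"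
          unfolding prod.distrib[symmetric] by (intro prod.cong) (auto simp: exp_add[symmetric] algebra_simps)
        also have "\<dots> = (\<Prod>i<k. exp ((1 - \<tau>) / 2 * u i)) * (\<Prod>i<k. exp ((1 - \<tau>) / 2 * u (Suc i mod k)))"
          using prod.reindex_bij_betw[OF bij_betw_Suc_mod[OF \<open>0 < k\<close>], of "\<lambda>i. exp ((1 - \<tau>) / 2 * u i)"] by simp
        also have "\<dots> = (\<Prod>i<k. exp ((u i + u (Suc i mod k)) * (1 - \<tau>) / 2))"
          unfolding prod.distrib[symmetric] by (intro prod.cong) (auto simp: exp_add[symmetric] field_simps)
        finally show ?thesis by (simp add: prod.distrib)
      qed
      also have "(\<Prod>i<k. f (exp (u i + u (Suc i mod k)))) * (c ^ k * (\<Prod>i<k. exp ((u i + u (Suc i mod k)) * (1 - \<tau>) / 2)))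
          = c ^ k * (\<Prod>i<k. log_kernel \<tau> f (u i + u (Suc i mod k)))"
        by (simp add: log_kernel_def prod.distrib)
      also have "ennreal \<dots> = ennreal (c ^ k) * (\<Prod>i<k. ennreal (log_kernel \<tau> f (u i + u (Suc i mod k))))"
      proof -
        have "0 \<le> log_kernel \<tau> f s" for s using nonneg by (simp add: log_kernel_def)
        then show ?thesis using c by (simp add: ennreal_mult prod_ennreal prod_nonneg)
      qed
      finally have "F (\<lambda>i\<in>{..<k}. max 1 (\<gamma> * exp (u i))) * (\<Prod>i<k. r (u i)) =
          ennreal (c ^ k) * (\<Prod>i<k. ennreal (log_kernel \<tau> f (u i + u (Suc i mod k))))" .
      moreover have "(\<Prod>i<k. indicator {- ln \<gamma>..} (u i) :: ennreal) = 1"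
        using True by simp
      ultimately show ?thesis by (simp only: mult_1_right)
    next
      case False
      then obtain i where i: "i < k" "u i < - ln \<gamma>" by force
      then have "(\<Prod>i<k. r (u i)) = 0" "(\<Prod>i<k. indicator {- ln \<gamma>..} (u i) :: ennreal) = 0"
        by (auto simp: r_def intro!: prod_zero bexI[of _ i])
      then show ?thesis by (simp only: mult_zero_right)
    qed
  qed
  also have "\<dots> = ennreal (c ^ k) * (\<integral>\<^sup>+u. (\<Prod>i<k. ennreal (log_kernel \<tau> f (u i + u (Suc i mod k)))) *
      (\<Prod>i<k. indicator {- ln \<gamma>..} (u i)) \<partial>PiM {..<k} (\<lambda>_. lborel))"
  proof (rule nn_integral_cmult)
    have "(\<lambda>s. f (exp s)) = (\<lambda>s. f0 (exp s))" by (simp add: f0_def max_def)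
    then have [measurable]: "(\<lambda>s. f (exp s)) \<in> borel_measurable borel" by simp
    have [measurable]: "log_kernel \<tau> f \<in> borel_measurable borel" unfolding log_kernel_def[abs_def] by measurable
    show "(\<lambda>u. (\<Prod>i<k. ennreal (log_kernel \<tau> f (u i + u (Suc i mod k)))) *
      (\<Prod>i<k. indicator {- ln \<gamma>..} (u i))) \<in> borel_measurable (PiM {..<k} (\<lambda>_. lborel))"
      using \<open>0 < k\<close> by measurable
  qed
  finally show ?thesis unfolding c_def .
qed

section \<open>Iterated convolutions\<close>

text \<open>A class stable under convolution. Boundedness makes the convolution defined at every
  point and not just almost everywhere, which matters because it is finally evaluated at 0.\<close>

definition bounded_density :: "(real \<Rightarrow> real) \<Rightarrow> bool" where
  "bounded_density a \<longleftrightarrow> integrable lborel a \<and> (\<forall>x. 0 \<le> a x) \<and> (\<exists>B. \<forall>x. a x \<le> B)"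

lemma bounded_densityD:
  assumes "bounded_density a"
  shows "integrable lborel a" "0 \<le> a x" "a \<in> borel_measurable borel"
proof -
  show i: "integrable lborel a" "0 \<le> a x" using assms by (auto simp: bounded_density_def)
  from i(1) show "a \<in> borel_measurable borel" using borel_measurable_integrable by fastforce
qed

text \<open>
  The argument of \<open>g\<close> is \<open>z + x\<close> because logarithms of neighbouring weights add up. Compared with a
  convolution, every step therefore reflects the previous function, hence the complex conjugate in
  \<open>fourier_convolution\<close>.
\<close>

primrec iterated_convolution :: "(real \<Rightarrow> real) \<Rightarrow> (real \<Rightarrow> real) \<Rightarrow> nat \<Rightarrow> real \<Rightarrow> real" where
  "iterated_convolution g a 0 = a"
| "iterated_convolution g a (Suc j) = (\<lambda>x. LBINT z. iterated_convolution g a j z * g (z + x))"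

text \<open>A bound on \<open>g\<close> dominates the integrand by a multiple of \<open>a\<close>.
  Tonelli and translation invariance give the pair integral as the product of the two masses; this
  joint integrability is what Fubini uses in \<open>fourier_convolution\<close>.\<close>

lemma
  assumes a: "bounded_density a" and g: "bounded_density g"
  shows integrable_convolution: "integrable lborel (\<lambda>z. a z * g (z + x))"
    and nn_integral_convolution:
      "(\<integral>\<^sup>+z. ennreal (a z) * ennreal (g (z + x)) \<partial>lborel) = ennreal (LBINT z. a z * g (z + x))"
    and integrable_convolution_pair:
      "integrable (lborel \<Otimes>\<^sub>M lborel) (\<lambda>(x, z). a z * g (z + x))"
    and bounded_density_convolution: "bounded_density (\<lambda>x. LBINT z. a z * g (z + x))"
proof -
  note [measurable] = bounded_densityD(3)[OF a] bounded_densityD(3)[OF g]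
  note pos = bounded_densityD(2)[OF a] bounded_densityD(2)[OF g]
  obtain B where B: "g x \<le> B" for x using g by (auto simp: bounded_density_def)
  have int: "integrable lborel (\<lambda>z. a z * g (z + x))" for x
  proof (rule Bochner_Integration.integrable_bound)
    show "integrable lborel (\<lambda>z. a z * B)" using bounded_densityD(1)[OF a] by simp
    show "AE z in lborel. norm (a z * g (z + x)) \<le> norm (a z * B)"
      using B pos by (intro AE_I2) (auto simp: abs_mult intro!: mult_left_mono order_trans[OF B])
  qed simp
  show "integrable lborel (\<lambda>z. a z * g (z + x))" by (rule int)
  show nn: "(\<integral>\<^sup>+z. ennreal (a z) * ennreal (g (z + x)) \<partial>lborel) = ennreal (LBINT z. a z * g (z + x))" for x
    using nn_integral_eq_integral[OF int[of x]] pos by (simp add: ennreal_mult)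
  have trans: "(\<integral>\<^sup>+x. ennreal (g (z + x)) \<partial>lborel) = ennreal (LBINT x. g x)" for z
  proof -
    have "(\<integral>\<^sup>+x. ennreal (g x) \<partial>lborel) = (\<integral>\<^sup>+x. ennreal (g (z + x)) \<partial>lborel)"
      by (subst nn_integral_real_affine[where c=1 and t=z]) auto
    then show ?thesis using nn_integral_eq_integral[OF bounded_densityD(1)[OF g]] pos by simp
  qed
  show pair: "integrable (lborel \<Otimes>\<^sub>M lborel) (\<lambda>(x, z). a z * g (z + x))"
  proof (rule integrableI_nonneg)
    have "(\<integral>\<^sup>+p. ennreal (case p of (x, z) \<Rightarrow> a z * g (z + x)) \<partial>(lborel \<Otimes>\<^sub>M lborel))
        = (\<integral>\<^sup>+z. \<integral>\<^sup>+x. ennreal (a z) * ennreal (g (z + x)) \<partial>lborel \<partial>lborel)"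
      by (subst lborel_pair.nn_integral_snd[symmetric]) (auto simp: pos ennreal_mult)
    also have "\<dots> = (\<integral>\<^sup>+z. ennreal (a z) * ennreal (LBINT x. g x) \<partial>lborel)"
      by (subst nn_integral_cmult) (auto simp: trans)
    also have "\<dots> = ennreal (LBINT x. a x) * ennreal (LBINT x. g x)"
      by (subst nn_integral_multc) (auto simp: nn_integral_eq_integral bounded_densityD a pos)
    also have "\<dots> < \<infinity>" by (simp add: ennreal_mult_less_top)
    finally show "(\<integral>\<^sup>+p. ennreal (case p of (x, z) \<Rightarrow> a z * g (z + x)) \<partial>(lborel \<Otimes>\<^sub>M lborel)) < \<infinity>" .
  qed (auto simp: pos)
  have "(LBINT z. a z * g (z + x)) \<le> (LBINT z. a z * B)" for x
    using int bounded_densityD(1)[OF a] pos B by (intro integral_mono) (auto intro: mult_left_mono)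
  moreover have "integrable lborel (\<lambda>x. LBINT z. a z * g (z + x))"
    using lborel_pair.integrable_fst[OF pair] by simp
  ultimately show "bounded_density (\<lambda>x. LBINT z. a z * g (z + x))"
    unfolding bounded_density_def by (auto simp: pos intro!: Bochner_Integration.integral_nonneg)
qed

lemma bounded_density_iterated_convolution: "bounded_density g \<Longrightarrow> bounded_density a \<Longrightarrow> bounded_density (iterated_convolution g a j)"
  by (induction j) (auto intro!: bounded_density_convolution)

lemma nn_integral_iterated_convolution:
  assumes "bounded_density g" "bounded_density a"
  shows "(\<integral>\<^sup>+z. ennreal (iterated_convolution g a j z) * ennreal (g (z + x)) \<partial>lborel) = ennreal (iterated_convolution g a (Suc j) x)"
  using nn_integral_convolution[OF bounded_density_iterated_convolution[OF assms] assms(1)] by simp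

text \<open>Continuity is inherited from the last factor \<open>g\<close> by dominated convergence.
  It is what allows Fourier inversion to yield the value at the single point 0.\<close>

lemma isCont_iterated_convolution_Suc:
  assumes "bounded_density g" "bounded_density a" "continuous_on UNIV g"
  shows "isCont (iterated_convolution g a (Suc j)) x"
proof -
  define b where "b = iterated_convolution g a j"
  have b: "bounded_density b" unfolding b_def using assms bounded_density_iterated_convolution by blast
  note [measurable] = bounded_densityD(3)[OF b] bounded_densityD(3)[OF assms(1)]
  obtain B where B: "g x \<le> B" for x using assms(1) by (auto simp: bounded_density_def)
  have "isCont (\<lambda>x. LBINT z. b z * g (z + x)) x"
    unfolding continuous_at_sequentially comp_def
  proof (intro allI impI)
    fix u :: "nat \<Rightarrow> real" assume u: "u \<longlonglongrightarrow> x"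
    show "(\<lambda>n. LBINT z. b z * g (z + u n)) \<longlonglongrightarrow> (LBINT z. b z * g (z + x))"
    proof (rule integral_dominated_convergence)
      show "integrable lborel (\<lambda>z. b z * B)" using bounded_densityD(1)[OF b] by simp
      show "AE z in lborel. (\<lambda>n. b z * g (z + u n)) \<longlonglongrightarrow> b z * g (z + x)"
        using assms(3) u by (intro AE_I2 tendsto_mult tendsto_const continuous_on_tendsto_compose[OF assms(3)] tendsto_add) auto
      show "AE z in lborel. norm (b z * g (z + u n)) \<le> b z * B" for n
        using bounded_densityD(2)[OF b] bounded_densityD(2)[OF assms(1)] B by (intro AE_I2) (auto simp: abs_mult intro!: mult_left_mono)
    qed auto
  qed
  then show ?thesis by (simp add: b_def)
qed

text \<open>An integral over a path of variables is an iterated convolution tested against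
  \<open>F\<close>. A general \<open>F\<close> lets the induction absorb the newest edge factor; a
  general seed \<open>a\<close> covers both the integrand and its dominating function, which carries
  an extra weight on the first factor.\<close>

lemma nn_integral_PiM_iterated_convolution:
  assumes g: "bounded_density g" and a: "bounded_density a" and F: "F \<in> borel_measurable borel"
  shows "(\<integral>\<^sup>+s. ennreal (a (s 1)) * (\<Prod>i\<in>{1..<Suc j}. ennreal (g (s i + s (Suc i)))) * F (s (Suc j))
      \<partial>PiM {1..Suc j} (\<lambda>_. lborel)) = (\<integral>\<^sup>+x. ennreal (iterated_convolution g a j x) * F x \<partial>lborel)"
  using F
proof (induction j arbitrary: F)
  interpret product_sigma_finite "\<lambda>_::nat. lborel :: real measure"
    by (simp add: product_sigma_finite_def lborel.sigma_finite_measure_axioms)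
  note [measurable] = bounded_densityD(3)[OF a] bounded_densityD(3)[OF g]
  {
    case 0
    note [measurable] = 0
    show ?case
      using product_nn_integral_singleton[of "\<lambda>x. ennreal (a x) * F x" 1] by simp
  next
    case (Suc j)
    note [measurable] = Suc.prems
    have ins: "{1..Suc (Suc j)} = insert (Suc (Suc j)) {1..Suc j}" by auto
    have [measurable]: "iterated_convolution g a j \<in> borel_measurable borel"
      using bounded_density_iterated_convolution[OF g a] bounded_densityD(3) by blast
    have [simp]: "Suc (Suc j) \<noteq> 1" "i \<in> {1..Suc j} \<Longrightarrow> i \<noteq> Suc (Suc j)" for i by auto
    have "(\<integral>\<^sup>+s. ennreal (a (s 1)) * (\<Prod>i\<in>{1..<Suc (Suc j)}. ennreal (g (s i + s (Suc i)))) * F (s (Suc (Suc j)))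
      \<partial>PiM {1..Suc (Suc j)} (\<lambda>_. lborel)) =
      (\<integral>\<^sup>+y. \<integral>\<^sup>+s. ennreal (a ((s(Suc (Suc j) := y)) 1)) *
         (\<Prod>i\<in>{1..<Suc (Suc j)}. ennreal (g ((s(Suc (Suc j) := y)) i + (s(Suc (Suc j) := y)) (Suc i)))) *
         F ((s(Suc (Suc j) := y)) (Suc (Suc j))) \<partial>PiM {1..Suc j} (\<lambda>_. lborel) \<partial>lborel)"
      unfolding ins
    proof (rule product_nn_integral_insert_rev)
      show "(\<lambda>s. ennreal (a (s 1)) * (\<Prod>i\<in>{1..<Suc (Suc j)}. ennreal (g (s i + s (Suc i)))) * F (s (Suc (Suc j))))
        \<in> borel_measurable (PiM (insert (Suc (Suc j)) {1..Suc j}) (\<lambda>_. lborel))"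
        unfolding ins[symmetric] by measurable
    qed auto
    also have "\<dots> = (\<integral>\<^sup>+y. \<integral>\<^sup>+s. ennreal (a (s 1)) * (\<Prod>i\<in>{1..<Suc j}. ennreal (g (s i + s (Suc i)))) *
        (ennreal (g (s (Suc j) + y)) * F y) \<partial>PiM {1..Suc j} (\<lambda>_. lborel) \<partial>lborel)"
    proof (intro nn_integral_cong)
      fix y and s :: "nat \<Rightarrow> real"
      have "(\<Prod>i\<in>{1..<Suc (Suc j)}. ennreal (g ((s(Suc (Suc j) := y)) i + (s(Suc (Suc j) := y)) (Suc i))))
        = (\<Prod>i\<in>{1..<Suc j}. ennreal (g (s i + s (Suc i)))) * ennreal (g (s (Suc j) + y))"
        by (subst prod.atLeastLessThan_Suc) (auto intro!: arg_cong2[where f="(*)"] prod.cong)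
      then show "ennreal (a ((s(Suc (Suc j) := y)) 1)) *
         (\<Prod>i\<in>{1..<Suc (Suc j)}. ennreal (g ((s(Suc (Suc j) := y)) i + (s(Suc (Suc j) := y)) (Suc i)))) *
         F ((s(Suc (Suc j) := y)) (Suc (Suc j))) =
         ennreal (a (s 1)) * (\<Prod>i\<in>{1..<Suc j}. ennreal (g (s i + s (Suc i)))) * (ennreal (g (s (Suc j) + y)) * F y)"
        by (simp only: fun_upd_same fun_upd_other) (simp add: mult.assoc)
    qed
    also have "\<dots> = (\<integral>\<^sup>+y. \<integral>\<^sup>+z. ennreal (iterated_convolution g a j z) * (ennreal (g (z + y)) * F y) \<partial>lborel \<partial>lborel)"
      by (intro nn_integral_cong Suc.IH) measurable
    also have "\<dots> = (\<integral>\<^sup>+y. ennreal (iterated_convolution g a (Suc j) y) * F y \<partial>lborel)"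
      unfolding nn_integral_iterated_convolution[OF g a, symmetric]
      by (intro nn_integral_cong) (simp add: nn_integral_multc[symmetric] mult.assoc)
    finally show ?case .
  }
qed

section \<open>Asymptotics of the cyclic integral\<close>

definition cycle_integral :: "(real \<Rightarrow> real) \<Rightarrow> nat \<Rightarrow> real \<Rightarrow> ennreal" where
  "cycle_integral g k L = (\<integral>\<^sup>+u. (\<Prod>i<k. ennreal (g (u i + u (Suc i mod k)))) *
      (\<Prod>i<k. indicator {- L..} (u i)) \<partial>PiM {..<k} (\<lambda>_. lborel))"

text \<open>
  The admissible shifts \<open>t\<close>; the coordinate transverse to them is normalised by \<open>s 0 = 0\<close>, whatever the
  value of the undefined component \<open>s 0\<close> of a point of the product over \<open>{1..<k}\<close>.
\<close>

definition shift_length :: "nat \<Rightarrow> real \<Rightarrow> (nat \<Rightarrow> real) \<Rightarrow> ennreal" where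
  "shift_length k L s = (\<integral>\<^sup>+t. (\<Prod>i<k. indicator {- L..} ((- 1) ^ i * t + (s(0 := 0)) i)) \<partial>lborel)"

lemma measurable_fun_upd_component [measurable]:
  "(i::nat) < k \<Longrightarrow> (\<lambda>s. (s(0 := x)) i) \<in> borel_measurable (PiM {1..<k} (\<lambda>_. lborel :: real measure))"
  unfolding One_nat_def by (cases "i = 0") auto

lemma measurable_shift_length [measurable]:
  "shift_length k L \<in> borel_measurable (PiM {1..<k} (\<lambda>_. lborel))"
  unfolding shift_length_def[abs_def]
proof (rule lborel.borel_measurable_nn_integral)
  have *: "(\<lambda>p. indicator {- L..} ((- 1) ^ i * snd p + ((fst p)(0 := 0)) i) :: ennreal)
      \<in> borel_measurable (PiM {1..<k} (\<lambda>_. lborel) \<Otimes>\<^sub>M lborel)" if "i < k" for i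
    using that by (cases "i = 0") auto
  show "(\<lambda>(s, t). \<Prod>i<k. indicator {- L..} ((- 1) ^ i * t + (s(0 := 0)) i) :: ennreal)
      \<in> borel_measurable (PiM {1..<k} (\<lambda>_. lborel) \<Otimes>\<^sub>M lborel)"
    unfolding split_beta' by (intro borel_measurable_prod_ennreal) (use * in auto)
qed

text \<open>The coordinate with index 0 becomes the shift parameter \<open>t\<close>, and the others
  are translated by \<open>(- 1) ^ i * t\<close>. This preserves Lebesgue measure and every edge
  argument, so \<open>t\<close> survives only in the cut-off and can be integrated first.\<close>

lemma cycle_integral_eq:
  assumes "even k" "0 < k" and g[measurable]: "g \<in> borel_measurable borel"
  shows "cycle_integral g k L = (\<integral>\<^sup>+s. (\<Prod>i<k. ennreal (g ((s(0 := 0)) i + (s(0 := 0)) (Suc i mod k)))) *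
      shift_length k L s \<partial>PiM {1..<k} (\<lambda>_. lborel))"
proof -
  interpret product_sigma_finite "\<lambda>_::nat. lborel :: real measure"
    by (simp add: product_sigma_finite_def lborel.sigma_finite_measure_axioms)
  interpret PI: sigma_finite_measure "PiM {1..<k} (\<lambda>_. lborel :: real measure)"
    by (rule sigma_finite) simp
  interpret pair: pair_sigma_finite "PiM {1..<k} (\<lambda>_. lborel :: real measure)" lborel ..
  let ?M = "\<lambda>I. PiM I (\<lambda>_::nat. lborel :: real measure)"
  define P where "P s = (\<Prod>i<k. ennreal (g ((s(0 := 0)) i + (s(0 := 0)) (Suc i mod k))))" for s :: "nat \<Rightarrow> real"
  define A :: "real \<Rightarrow> (nat \<Rightarrow> real) \<Rightarrow> ennreal"
    where "A t s = (\<Prod>i<k. indicator {- L..} ((- 1) ^ i * t + (s(0 := 0)) i))" for t s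
  define F :: "(nat \<Rightarrow> real) \<Rightarrow> ennreal"
    where "F u = (\<Prod>i<k. ennreal (g (u i + u (Suc i mod k)))) * (\<Prod>i<k. indicator {- L..} (u i))" for u
  have ins: "{..<k} = insert 0 {1..<k}" using \<open>0 < k\<close> by auto
  have modk: "Suc i mod k < k" for i using \<open>0 < k\<close> by simp
  have F[measurable]: "F \<in> borel_measurable (?M {..<k})"
    unfolding F_def using modk by measurable
  have P[measurable]: "P \<in> borel_measurable (?M {1..<k})"
    unfolding P_def
    by (intro borel_measurable_prod_ennreal measurable_compose[OF _ measurable_ennreal]
        measurable_compose[OF _ g] borel_measurable_add measurable_fun_upd_component modk) simp
  have *: "(\<lambda>p. indicator {- L..} ((- 1) ^ i * snd p + ((fst p)(0 := 0)) i) :: ennreal)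
      \<in> borel_measurable (?M {1..<k} \<Otimes>\<^sub>M lborel)" if "i < k" for i
    using that by (cases "i = 0") auto
  have A[measurable]: "(\<lambda>p. A (snd p) (fst p)) \<in> borel_measurable (?M {1..<k} \<Otimes>\<^sub>M lborel)"
    unfolding A_def by (intro borel_measurable_prod_ennreal) (use * in auto)
  have "cycle_integral g k L = (\<integral>\<^sup>+u. F u \<partial>?M (insert 0 {1..<k}))"
    unfolding cycle_integral_def F_def ins[symmetric] ..
  also have "\<dots> = (\<integral>\<^sup>+t. \<integral>\<^sup>+s. F (s(0 := t)) \<partial>?M {1..<k} \<partial>lborel)"
    using F ins by (intro product_nn_integral_insert_rev) simp_all
  also have "\<dots> = (\<integral>\<^sup>+t. \<integral>\<^sup>+s. P s * A t s \<partial>?M {1..<k} \<partial>lborel)"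
  proof (rule nn_integral_cong)
    fix t :: real
    have "(\<lambda>s. s(0 := t)) \<in> measurable (?M {1..<k}) (?M {..<k})"
      unfolding ins by (rule measurable_fun_upd[where J="{1..<k}"]) auto
    from measurable_compose[OF this F]
    have "(\<integral>\<^sup>+s. F (s(0 := t)) \<partial>?M {1..<k}) =
        (\<integral>\<^sup>+s. F ((\<lambda>i\<in>{1..<k}. (- 1) ^ i * t + s i)(0 := t)) \<partial>?M {1..<k})"
      by (intro nn_integral_PiM_lborel_translate) auto
    also have "\<dots> = (\<integral>\<^sup>+s. P s * A t s \<partial>?M {1..<k})"
    proof (rule nn_integral_cong)
      fix s :: "nat \<Rightarrow> real"
      have 1: "((\<lambda>i\<in>{1..<k}. (- 1) ^ i * t + s i)(0 := t)) i = (- 1) ^ i * t + (s(0 := 0)) i" if "i < k" for i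
        using that by (cases "i = 0") auto
      \<comment> \<open>Parity enters here: the closing edge joins position \<open>k - 1\<close> to
        position 0, and its signs cancel because \<open>k - 1\<close> is odd.\<close>
      have 2: "(- 1) ^ i * t + (- 1) ^ (Suc i mod k) * t = 0" if "i < k" for i
      proof (cases "Suc i = k")
        case True
        then have "odd i" using assms by auto
        then show ?thesis using True by simp
      next
        case False
        then show ?thesis using that by simp
      qed
      have 3: "((- 1) ^ i * t + (s(0 := 0)) i) + ((- 1) ^ (Suc i mod k) * t + (s(0 := 0)) (Suc i mod k))
          = (s(0 := 0)) i + (s(0 := 0)) (Suc i mod k)" if "i < k" for i
        using 2[OF that] by linarith
      show "F ((\<lambda>i\<in>{1..<k}. (- 1) ^ i * t + s i)(0 := t)) = P s * A t s"
        unfolding F_def P_def A_def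
        by (intro arg_cong2[where f="(*)"] prod.cong refl) (simp_all only: lessThan_iff 1 modk 3)
    qed
    finally show "(\<integral>\<^sup>+s. F (s(0 := t)) \<partial>?M {1..<k}) = (\<integral>\<^sup>+s. P s * A t s \<partial>?M {1..<k})" .
  qed
  also have "\<dots> = (\<integral>\<^sup>+s. \<integral>\<^sup>+t. P s * A t s \<partial>lborel \<partial>?M {1..<k})"
  proof (rule pair.Fubini')
    show "(\<lambda>(s, t). P s * A t s) \<in> borel_measurable (?M {1..<k} \<Otimes>\<^sub>M lborel)"
      unfolding split_beta' by (rule borel_measurable_times_ennreal[OF _ A]) measurable
  qed
  also have "\<dots> = (\<integral>\<^sup>+s. P s * shift_length k L s \<partial>?M {1..<k})"
  proof (rule nn_integral_cong)
    fix s assume s: "s \<in> space (?M {1..<k})"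
    have "(\<lambda>t. A t s) \<in> borel_measurable lborel"
      unfolding A_def by measurable
    then show "(\<integral>\<^sup>+t. P s * A t s \<partial>lborel) = P s * shift_length k L s"
      unfolding shift_length_def A_def[symmetric] by (rule nn_integral_cmult)
  qed
  finally show ?thesis unfolding P_def .
qed

section \<open>Length of the interval of admissible shifts\<close>

text \<open>Only the constraints at positions 0 and 1 are kept: they confine \<open>t\<close> to
  \<open>{- L..L + s 1}\<close>. The resulting bound involves one variable, so a first moment of a
  single kernel suffices for domination.\<close>

lemma shift_length_le:
  assumes "1 < k" "0 \<le> L"
  shows "shift_length k L s \<le> ennreal (2 * L + \<bar>s 1\<bar>)"
proof -
  have "shift_length k L s \<le> (\<integral>\<^sup>+t. indicator {- L..L + s 1} t \<partial>lborel)"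
    unfolding shift_length_def
  proof (rule nn_integral_mono)
    fix t :: real
    show "(\<Prod>i<k. indicator {- L..} ((- 1) ^ i * t + (s(0 := 0)) i)) \<le> (indicator {- L..L + s 1} t :: ennreal)"
    proof (cases "t \<in> {- L..L + s 1}")
      case False
      \<comment> \<open>The position whose constraint is violated: 0 if \<open>t\<close> lies below
        the interval, 1 if it lies above.\<close>
      define j where "j = (if - L \<le> t then 1 else 0 :: nat)"
      have "j < k" "\<not> - L \<le> (- 1) ^ j * t + (s(0 := 0)) j"
        using False assms by (auto simp: j_def)
      then have zero: "(\<Prod>i<k. indicator {- L..} ((- 1) ^ i * t + (s(0 := 0)) i) :: ennreal) = 0"
        by (intro prod_zero bexI[of _ j]) (auto simp: indicator_def)
      show ?thesis unfolding zero by simp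
    qed (auto intro!: prod_le_1 simp: indicator_def)
  qed
  also have "\<dots> \<le> ennreal (2 * L + \<bar>s 1\<bar>)"
    using assms by (cases "- L \<le> L + s 1") (simp_all add: emeasure_lborel_Icc_eq ennreal_leI del: ennreal_plus)
  finally show ?thesis .
qed

text \<open>The sum of all offsets bounds each of them, so every \<open>t\<close> in the interval
  shortened by this sum at both ends satisfies all constraints. When the shortened interval is
  empty, \<open>ennreal\<close> turns the negative bound into 0.\<close>

lemma shift_length_ge:
  "ennreal (2 * L - 2 * (\<Sum>i<k. \<bar>(s(0 := 0)) i\<bar>)) \<le> shift_length k L s"
proof -
  define m where "m = (\<Sum>i<k. \<bar>(s(0 := 0)) i\<bar>)"
  have m: "\<bar>(s(0 := 0)) i\<bar> \<le> m" if "i < k" for i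
    unfolding m_def using that by (intro member_le_sum) auto
  have "ennreal (2 * L - 2 * m) \<le> (\<integral>\<^sup>+t. indicator {- L + m..L - m} t \<partial>lborel)"
    by (auto simp: emeasure_lborel_Icc_eq ennreal_neg intro!: ennreal_leI)
  also have "\<dots> \<le> shift_length k L s"
    unfolding shift_length_def
  proof (rule nn_integral_mono)
    fix t :: real
    show "(indicator {- L + m..L - m} t :: ennreal) \<le> (\<Prod>i<k. indicator {- L..} ((- 1) ^ i * t + (s(0 := 0)) i))"
    proof (cases "t \<in> {- L + m..L - m}")
      case True
      have "- L \<le> (- 1) ^ i * t + (s(0 := 0)) i" if "i < k" for i
        using True m[OF that] by (cases "even i") (auto simp del: fun_upd_apply)
      then have one: "(\<Prod>i<k. indicator {- L..} ((- 1) ^ i * t + (s(0 := 0)) i) :: ennreal) = 1"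
        by (intro prod.neutral) (auto simp: indicator_def simp del: fun_upd_apply)
      show ?thesis unfolding one by (simp add: indicator_def)
    qed simp
  qed
  finally show ?thesis unfolding m_def .
qed

lemma shift_length_tendsto:
  assumes "1 < k" "filterlim L at_top sequentially" "\<And>n. 1 \<le> L n"
  shows "(\<lambda>n. shift_length k (L n) s / ennreal (2 * L n)) \<longlonglongrightarrow> 1"
proof -
  define m where "m = (\<Sum>i<k. \<bar>(s(0 := 0)) i\<bar>)"
  have L: "0 < L n" for n using assms(3)[of n] by linarith
  have inv: "(\<lambda>n. c / L n) \<longlonglongrightarrow> 0" for c
    by (rule tendsto_divide_0[OF tendsto_const filterlim_at_top_imp_at_infinity[OF assms(2)]])
  have lo: "(\<lambda>n. ennreal (1 - m / L n)) \<longlonglongrightarrow> ennreal 1"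
    using tendsto_diff[OF tendsto_const inv, of 1 m] by (intro tendsto_ennrealI) simp
  have hi: "(\<lambda>n. ennreal (1 + (\<bar>s 1\<bar> / 2) / L n)) \<longlonglongrightarrow> ennreal 1"
    using tendsto_add[OF tendsto_const inv, of 1 "\<bar>s 1\<bar> / 2"] by (intro tendsto_ennrealI) simp
  show ?thesis
  proof (rule tendsto_sandwich[OF _ _ lo[unfolded ennreal_1] hi[unfolded ennreal_1]])
    show "\<forall>\<^sub>F n in sequentially. ennreal (1 - m / L n) \<le> shift_length k (L n) s / ennreal (2 * L n)"
    proof (intro always_eventually allI)
      fix n
      show "ennreal (1 - m / L n) \<le> shift_length k (L n) s / ennreal (2 * L n)"
      proof (cases "2 * L n - 2 * m \<ge> 0")
        case True
        have "ennreal (1 - m / L n) = ennreal (2 * L n - 2 * m) / ennreal (2 * L n)"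
          using True L[of n] by (subst divide_ennreal) (auto simp: field_simps)
        also have "\<dots> \<le> shift_length k (L n) s / ennreal (2 * L n)"
          unfolding m_def by (intro divide_right_mono_ennreal shift_length_ge)
        finally show ?thesis .
      next
        case False
        then have "1 - m / L n \<le> 0" using L[of n] by (simp add: field_simps)
        then show ?thesis by (simp add: ennreal_neg)
      qed
    qed
    show "\<forall>\<^sub>F n in sequentially. shift_length k (L n) s / ennreal (2 * L n) \<le> ennreal (1 + (\<bar>s 1\<bar> / 2) / L n)"
    proof (intro always_eventually allI)
      fix n
      have "shift_length k (L n) s / ennreal (2 * L n) \<le> ennreal (2 * L n + \<bar>s 1\<bar>) / ennreal (2 * L n)"
        using L[of n] assms(1) by (intro divide_right_mono_ennreal shift_length_le) auto
      also have "\<dots> = ennreal (1 + (\<bar>s 1\<bar> / 2) / L n)"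
        using L[of n] by (subst divide_ennreal) (auto simp: field_simps)
      finally show "shift_length k (L n) s / ennreal (2 * L n) \<le> ennreal (1 + (\<bar>s 1\<bar> / 2) / L n)" .
    qed
  qed
qed

text \<open>For fixed \<open>s\<close> the normalised shift length tends to 1 and is at most
  \<open>1 + \<bar>s 1\<bar>\<close> once \<open>L\<close> is at least 1. Attaching this weight to
  the first kernel factor gives a finite dominating integral, hence the assumption on the weighted
  kernel.\<close>

lemma cycle_integral_asymptotics:
  assumes g: "bounded_density g" and a: "bounded_density (\<lambda>s. (1 + \<bar>s\<bar>) * g s)"
    and k: "even k" "k = Suc (Suc j)" and L: "filterlim L at_top sequentially"
  shows "(\<lambda>n. cycle_integral g k (L n) / ennreal (2 * L n)) \<longlonglongrightarrow> ennreal (iterated_convolution g g (Suc j) 0)"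
proof -
  note [measurable] = bounded_densityD(3)[OF g] bounded_densityD(3)[OF a]
  let ?M = "PiM {1..Suc j} (\<lambda>_::nat. lborel :: real measure)"
  \<comment> \<open>Clipping at 1 makes the domination valid for every \<open>n\<close>; the
    sequence is eventually unchanged.\<close>
  define L' where "L' n = max 1 (L n)" for n
  have L'1: "1 \<le> L' n" for n by (simp add: L'_def)
  have ev: "eventually (\<lambda>n. L' n = L n) sequentially"
    using filterlim_at_top[THEN iffD1, OF L, rule_format, of 1] by eventually_elim (simp add: L'_def)
  have L': "filterlim L' at_top sequentially"
    using L filterlim_cong[OF refl refl ev] by simp
  have I: "{1..<k} = {1..Suc j}" using k by auto
  \<comment> \<open>All factors except the first, which the dominating function replaces by its
    weighted version.\<close>
  define R where "R s = (\<Prod>i\<in>{1..<Suc j}. ennreal (g (s i + s (Suc i)))) * ennreal (g (s (Suc j)))" for s :: "nat \<Rightarrow> real"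
  define P where "P s = ennreal (g (s 1)) * R s" for s
  have P: "(\<Prod>i<k. ennreal (g ((s(0 := 0)) i + (s(0 := 0)) (Suc i mod k)))) = P s" for s
  proof -
    \<comment> \<open>With position 0 pinned at 0, its two edges contribute \<open>g (s 1)\<close>
      and \<open>g (s (Suc j))\<close>, and the cycle opens into a path on
      \<open>{1..Suc j}\<close>.\<close>
    have "(\<Prod>i<k. ennreal (g ((s(0 := 0)) i + (s(0 := 0)) (Suc i mod k)))) =
       (\<Prod>i\<in>{0..<Suc j}. ennreal (g ((s(0 := 0)) i + s (Suc i)))) * ennreal (g (s (Suc j)))"
      unfolding k(2) lessThan_atLeast0
      by (subst prod.atLeast0_lessThan_Suc) (auto intro!: arg_cong2[where f="(*)"] prod.cong)
    also have "(\<Prod>i\<in>{0..<Suc j}. ennreal (g ((s(0 := 0)) i + s (Suc i)))) =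
       ennreal (g (s 1)) * (\<Prod>i\<in>{1..<Suc j}. ennreal (g (s i + s (Suc i))))"
      by (subst prod.atLeast_Suc_lessThan) (auto intro!: arg_cong2[where f="(*)"] prod.cong)
    finally show ?thesis by (simp add: P_def R_def mult.assoc)
  qed
  have R[measurable]: "R \<in> borel_measurable ?M" unfolding R_def by measurable
  have P_meas[measurable]: "P \<in> borel_measurable ?M" unfolding P_def by measurable
  have W[measurable]: "shift_length k l \<in> borel_measurable ?M" for l
    using measurable_shift_length[of k l] unfolding I .
  have eq: "cycle_integral g k (L' n) / ennreal (2 * L' n) =
      (\<integral>\<^sup>+s. P s * (shift_length k (L' n) s / ennreal (2 * L' n)) \<partial>?M)" for n
  proof -
    have "cycle_integral g k (L' n) = (\<integral>\<^sup>+s. P s * shift_length k (L' n) s \<partial>?M)"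
      unfolding P[symmetric] I[symmetric] by (rule cycle_integral_eq) (use k in auto)
    then show ?thesis
      unfolding ennreal_times_divide by (simp only:) (rule nn_integral_divide[symmetric], measurable)
  qed
  have "(\<lambda>n. \<integral>\<^sup>+s. P s * (shift_length k (L' n) s / ennreal (2 * L' n)) \<partial>?M)
     \<longlonglongrightarrow> (\<integral>\<^sup>+s. P s \<partial>?M)"
  proof (rule nn_integral_dominated_convergence)
    show "AE s in ?M. P s * (shift_length k (L' n) s / ennreal (2 * L' n)) \<le> ennreal ((1 + \<bar>s 1\<bar>) * g (s 1)) * R s" for n
    proof (rule AE_I2)
      fix s
      have "shift_length k (L' n) s / ennreal (2 * L' n) \<le> ennreal (2 * L' n + \<bar>s 1\<bar>) / ennreal (2 * L' n)"
        using L'1[of n] k by (intro divide_right_mono_ennreal shift_length_le) auto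
      also have "\<dots> \<le> ennreal (1 + \<bar>s 1\<bar>)"
      proof -
        have "\<bar>s 1\<bar> / (2 * L' n) \<le> \<bar>s 1\<bar> / 1"
          using L'1[of n] by (intro divide_left_mono) auto
        moreover have "(2 * L' n + \<bar>s 1\<bar>) / (2 * L' n) = 1 + \<bar>s 1\<bar> / (2 * L' n)"
          using L'1[of n] by (simp add: add_divide_distrib)
        ultimately have "(2 * L' n + \<bar>s 1\<bar>) / (2 * L' n) \<le> 1 + \<bar>s 1\<bar>"
          by simp
        then show ?thesis using L'1[of n] by (subst divide_ennreal) (simp_all add: ennreal_leI del: ennreal_plus)
      qed
      finally have "P s * (shift_length k (L' n) s / ennreal (2 * L' n)) \<le> P s * ennreal (1 + \<bar>s 1\<bar>)"
        by (rule mult_left_mono) simp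
      also have "\<dots> = ennreal ((1 + \<bar>s 1\<bar>) * g (s 1)) * R s"
        by (simp add: P_def ennreal_mult bounded_densityD(2)[OF g] mult_ac)
      finally show "P s * (shift_length k (L' n) s / ennreal (2 * L' n)) \<le> ennreal ((1 + \<bar>s 1\<bar>) * g (s 1)) * R s" .
    qed
    have "(\<integral>\<^sup>+s. ennreal ((1 + \<bar>s 1\<bar>) * g (s 1)) * R s \<partial>?M)
        = (\<integral>\<^sup>+x. ennreal (iterated_convolution g (\<lambda>s. (1 + \<bar>s\<bar>) * g s) j x) * ennreal (g x) \<partial>lborel)"
      unfolding R_def mult.assoc[symmetric] by (rule nn_integral_PiM_iterated_convolution[OF g a]) auto
    also have "\<dots> < \<infinity>"
      using nn_integral_iterated_convolution[OF g a, of j 0] by (simp del: iterated_convolution.simps)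
    finally show "(\<integral>\<^sup>+s. ennreal ((1 + \<bar>s 1\<bar>) * g (s 1)) * R s \<partial>?M) < \<infinity>" .
    show "AE s in ?M. (\<lambda>n. P s * (shift_length k (L' n) s / ennreal (2 * L' n))) \<longlonglongrightarrow> P s"
    proof (rule AE_I2)
      fix s
      \<comment> \<open>Finiteness of the fixed factor is required for multiplication by it to
        commute with limits in the extended nonnegative reals.\<close>
      have "P s < \<top>" unfolding P_def R_def by (auto simp: ennreal_mult_less_top prod_ennreal bounded_densityD(2)[OF g])
      then have "(\<lambda>n. P s * (shift_length k (L' n) s / ennreal (2 * L' n))) \<longlonglongrightarrow> P s * 1"
        using k by (intro ennreal_tendsto_cmult shift_length_tendsto L' L'1) auto
      then show "(\<lambda>n. P s * (shift_length k (L' n) s / ennreal (2 * L' n))) \<longlonglongrightarrow> P s"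
        by simp
    qed
  qed measurable
  also have "(\<integral>\<^sup>+s. P s \<partial>?M) = ennreal (iterated_convolution g g (Suc j) 0)"
  proof -
    have "(\<integral>\<^sup>+s. P s \<partial>?M) = (\<integral>\<^sup>+x. ennreal (iterated_convolution g g j x) * ennreal (g x) \<partial>lborel)"
      unfolding P_def R_def mult.assoc[symmetric] by (rule nn_integral_PiM_iterated_convolution[OF g g]) auto
    then show ?thesis using nn_integral_iterated_convolution[OF g g, of j 0] by (simp del: iterated_convolution.simps)
  qed
  finally have "(\<lambda>n. cycle_integral g k (L' n) / ennreal (2 * L' n)) \<longlonglongrightarrow> ennreal (iterated_convolution g g (Suc j) 0)"
    unfolding eq .
  then show ?thesis
    by (rule Lim_transform_eventually) (use ev in \<open>eventually_elim, simp\<close>)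
qed

section \<open>Fourier inversion\<close>

text \<open>With \<open>2 * pi\<close> in the exponent, the inversion formula carries no further
  constant.\<close>

definition fourier :: "(real \<Rightarrow> real) \<Rightarrow> real \<Rightarrow> complex" where
  "fourier a v = (LBINT x. cis (- (2 * pi * v * x)) * of_real (a x))"

lemma borel_measurable_cis [measurable]: "cis \<in> borel_measurable borel"
  by (intro borel_measurable_continuous_onI continuous_intros)

lemma integrable_cis_mult:
  fixes \<theta> :: "'a \<Rightarrow> real" and a :: "'a \<Rightarrow> real"
  assumes "integrable M a" "\<theta> \<in> borel_measurable M"
  shows "integrable M (\<lambda>x. cis (\<theta> x) * of_real (a x))"
proof (rule Bochner_Integration.integrable_bound[OF assms(1)])
  show "(\<lambda>x. cis (\<theta> x) * of_real (a x)) \<in> borel_measurable M"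
    using borel_measurable_integrable[OF assms(1)] assms(2) by measurable
qed (auto simp: norm_mult)

lemma borel_measurable_fourier:
  assumes "bounded_density a"
  shows "fourier a \<in> borel_measurable borel"
proof -
  note [measurable] = bounded_densityD(3)[OF assms]
  show ?thesis unfolding fourier_def[abs_def] by measurable
qed

lemma norm_fourier_le:
  assumes "bounded_density a"
  shows "norm (fourier a v) \<le> (LBINT x. a x)"
proof -
  have "norm (fourier a v) \<le> (LBINT x. norm (cis (- (2 * pi * v * x)) * of_real (a x)))"
    unfolding fourier_def by (rule integral_norm_bound)
  then show ?thesis by (simp add: norm_mult bounded_densityD(2)[OF assms])
qed

text \<open>The character at \<open>x\<close> is the one at \<open>z + x\<close> times the conjugate
  of the one at \<open>z\<close>. After Fubini, translation of the inner variable separates the two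
  transforms.\<close>

lemma fourier_convolution:
  assumes a: "bounded_density a" and g: "bounded_density g"
  shows "fourier (\<lambda>x. LBINT z. a z * g (z + x)) v = cnj (fourier a v) * fourier g v"
proof -
  note [measurable] = bounded_densityD(3)[OF a] bounded_densityD(3)[OF g]
  let ?e = "\<lambda>x. cis (- (2 * pi * v * x))"
  have int: "integrable (lborel \<Otimes>\<^sub>M lborel) (\<lambda>p. ?e (fst p) * of_real (case p of (x, z) \<Rightarrow> a z * g (z + x)))"
    by (rule integrable_cis_mult[OF integrable_convolution_pair[OF a g]]) measurable
  have inner: "(LBINT x. ?e x * of_real (a z * g (z + x))) = cnj (?e z) * of_real (a z) * fourier g v" for z
  proof -
    have "fourier g v = (LBINT x. ?e (z + x) * of_real (g (z + x)))"
      unfolding fourier_def by (subst lborel_integral_real_affine[where c=1 and t=z]) auto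
    then have "cnj (?e z) * of_real (a z) * fourier g v =
        (LBINT x. cnj (?e z) * of_real (a z) * (?e (z + x) * of_real (g (z + x))))"
      by simp
    also have "\<dots> = (LBINT x. ?e x * of_real (a z * g (z + x)))"
    proof (rule Bochner_Integration.integral_cong[OF refl])
      fix x
      have "cnj (?e z) * ?e (z + x) = ?e x"
        by (simp add: cis_cnj cis_mult algebra_simps)
      then show "cnj (?e z) * of_real (a z) * (?e (z + x) * of_real (g (z + x))) = ?e x * of_real (a z * g (z + x))"
        by (simp only: of_real_mult flip: mult.assoc) (simp add: mult_ac)
    qed
    finally show ?thesis by simp
  qed
  have "fourier (\<lambda>x. LBINT z. a z * g (z + x)) v = (LBINT x. LBINT z. ?e x * of_real (a z * g (z + x)))"
    unfolding fourier_def by (simp del: of_real_mult flip: integral_complex_of_real)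
  also have "\<dots> = (LBINT z. LBINT x. ?e x * of_real (a z * g (z + x)))"
    by (rule lborel_pair.Fubini_integral[symmetric]) (use int in \<open>simp add: split_beta'\<close>)
  also have "\<dots> = (LBINT z. cnj (?e z * of_real (a z))) * fourier g v"
    unfolding inner by simp
  also have "(LBINT z. cnj (?e z * of_real (a z))) = cnj (fourier a v)"
    unfolding fourier_def by (rule Bochner_Integration.integral_cnj)
  finally show ?thesis .
qed

text \<open>A single step conjugates the previous transform; two steps cancel the conjugation and
  multiply by the squared modulus. After an odd number of steps an even number of kernels is
  involved and the transform is real and nonnegative, as the inversion argument demands.\<close>

lemma fourier_iterated_convolution_odd:
  assumes g: "bounded_density g"
  shows "fourier (iterated_convolution g g (Suc (2 * m))) v = of_real (cmod (fourier g v) ^ (2 * m + 2))"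
proof -
  have step: "fourier (iterated_convolution g g (Suc j)) v = cnj (fourier (iterated_convolution g g j) v) * fourier g v" for j
    using fourier_convolution[OF bounded_density_iterated_convolution[OF g g] g] by simp
  have sq: "cnj (fourier g v) * fourier g v = of_real ((cmod (fourier g v))\<^sup>2)"
    using complex_norm_square[of "fourier g v"] by (simp add: mult.commute)
  show ?thesis
  proof (induction m)
    case 0
    then show ?case using step[of 0] sq by (simp del: iterated_convolution.simps(2) add: power2_eq_square)
  next
    case (Suc m)
    have "fourier (iterated_convolution g g (Suc (2 * Suc m))) v =
        fourier (iterated_convolution g g (Suc (2 * m))) v * (cnj (fourier g v) * fourier g v)"
      using step[of "Suc (Suc (2 * m))"] step[of "Suc (2 * m)"] by (simp del: iterated_convolution.simps)
    then show ?case unfolding Suc.IH sq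
      by (simp add: power2_eq_square)
  qed
qed

section \<open>Gaussian regularisation and inversion at a point\<close>

lemma gaussian_fourier:
  "(LBINT w. cis (t * w) * of_real (std_normal_density w)) = of_real (exp (- t\<^sup>2 / 2))"
proof -
  have "char std_normal_distribution t = (LBINT w. std_normal_density w *\<^sub>R iexp (t * w))"
    unfolding char_def by (subst integral_density) auto
  also have "\<dots> = (LBINT w. cis (t * w) * of_real (std_normal_density w))"
    by (intro Bochner_Integration.integral_cong refl) (simp add: cis_conv_exp scaleR_conv_of_real mult.commute)
  finally show ?thesis by (simp add: char_std_normal_distribution)
qed

lemma integrable_std_normal_density: "integrable lborel std_normal_density"
  using integrable_normal_moment[of 1 0 0] by simp

text \<open>Fubini moves the transform from \<open>b\<close> onto the Gaussian, where it is
  explicit. Putting the scale into the argument of \<open>r\<close> keeps the Gaussian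
  standard.\<close>

lemma fourier_gaussian_parseval:
  assumes b: "bounded_density b" and r: "\<And>v. fourier b v = of_real (r v)" and "0 < \<epsilon>"
  shows "(LBINT w. r (w / \<epsilon>) * std_normal_density w) = (LBINT x. b x * exp (- (2 * pi * x / \<epsilon>)\<^sup>2 / 2))"
proof -
  note [measurable] = bounded_densityD(3)[OF b]
  have "integrable (lborel \<Otimes>\<^sub>M lborel) (\<lambda>(x, w). b x * std_normal_density w)"
    using bounded_densityD(1)[OF b] integrable_std_normal_density
    by (intro lborel_pair.Fubini_integrable) (auto simp: abs_mult intro!: integrable_abs)
  then have "integrable (lborel \<Otimes>\<^sub>M lborel) (\<lambda>p. cis (- (2 * pi * fst p / \<epsilon> * snd p)) *
      of_real (case p of (x, w) \<Rightarrow> b x * std_normal_density w))"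
    by (rule integrable_cis_mult) measurable
  then have int: "integrable (lborel \<Otimes>\<^sub>M lborel) (\<lambda>(x, w). cis (- (2 * pi * x / \<epsilon> * w)) *
      of_real (b x * std_normal_density w))"
    by (simp add: split_beta')
  have "complex_of_real (LBINT w. r (w / \<epsilon>) * std_normal_density w) =
      (LBINT w. LBINT x. cis (- (2 * pi * x / \<epsilon> * w)) * of_real (b x * std_normal_density w))"
  proof -
    have "complex_of_real (r (w / \<epsilon>) * std_normal_density w) =
        (LBINT x. cis (- (2 * pi * x / \<epsilon> * w)) * of_real (b x * std_normal_density w))" for w
    proof -
      have "complex_of_real (r (w / \<epsilon>) * std_normal_density w) = fourier b (w / \<epsilon>) * of_real (std_normal_density w)"
        by (simp only: of_real_mult r)
      also have "\<dots> = (LBINT x. cis (- (2 * pi * (w / \<epsilon>) * x)) * of_real (b x) * of_real (std_normal_density w))"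
        unfolding fourier_def by (rule integral_mult_left_zero[symmetric])
      finally show ?thesis by (simp add: mult_ac)
    qed
    then show ?thesis by (simp only: flip: integral_complex_of_real)
  qed
  also have "\<dots> = (LBINT x. LBINT w. cis (- (2 * pi * x / \<epsilon> * w)) * of_real (b x * std_normal_density w))"
    by (rule lborel_pair.Fubini_integral[OF int])
  also have "\<dots> = (LBINT x. of_real (b x) * (LBINT w. cis (- (2 * pi * x / \<epsilon>) * w) * of_real (std_normal_density w)))"
    by (simp add: mult_ac flip: integral_mult_right_zero)
  also have "\<dots> = of_real (LBINT x. b x * exp (- (2 * pi * x / \<epsilon>)\<^sup>2 / 2))"
    unfolding gaussian_fourier by (simp flip: integral_complex_of_real)
  finally show ?thesis by (simp only: of_real_eq_iff)
qed

text \<open>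
  Gaussian regularisation: as the transform is nonnegative, its regularised integrals increase to the
  full one, so that no integrability of the transform has to be assumed.
\<close>

lemma fourier_inversion_at_0:
  assumes b: "bounded_density b" "isCont b 0"
    and r: "\<And>v. fourier b v = of_real (r v)" "\<And>v. 0 \<le> r v"
  shows "(\<integral>\<^sup>+v. ennreal (r v) \<partial>lborel) = ennreal (b 0)"
proof -
  note b_meas[measurable] = bounded_densityD(3)[OF b(1)]
  obtain B where B: "b x \<le> B" for x using b by (auto simp: bounded_density_def)
  have "r v = Re (fourier b v)" for v using r by simp
  then have "r = (\<lambda>v. Re (fourier b v))" by auto
  then have r_meas[measurable]: "r \<in> borel_measurable borel"
    using borel_measurable_fourier[OF b(1)] by simp
  have rB: "r v \<le> (LBINT x. b x)" for v
    using norm_fourier_le[OF b(1), of v] r by simp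
  \<comment> \<open>In the Parseval identity, \<open>w = \<epsilon> * v\<close> on the left and
    \<open>x = \<epsilon> / (2 * pi) * z\<close> on the right turn \<open>r (w / \<epsilon>)\<close>
    into \<open>r v\<close> and the exponent into \<open>- z\<^sup>2 / 2\<close>; the same factor
    \<open>\<epsilon>\<close> appears on both sides and cancels.\<close>
  have key: "(\<integral>\<^sup>+v. ennreal (r v * exp (- (\<epsilon> * v)\<^sup>2 / 2)) \<partial>lborel)
      = ennreal (LBINT z. b (\<epsilon> / (2 * pi) * z) * std_normal_density z)" if "0 < \<epsilon>" for \<epsilon>
  proof -
    have ir: "integrable lborel (\<lambda>w. r (w / \<epsilon>) * std_normal_density w)"
    proof (rule Bochner_Integration.integrable_bound)
      show "integrable lborel (\<lambda>w. (LBINT x. b x) * std_normal_density w)"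
        using integrable_std_normal_density by simp
      show "AE w in lborel. norm (r (w / \<epsilon>) * std_normal_density w) \<le> norm ((LBINT x. b x) * std_normal_density w)"
        using rB r(2) by (intro AE_I2) (auto simp: abs_mult intro!: mult_right_mono order_trans[OF rB])
    qed simp
    have "ennreal \<epsilon> * (\<integral>\<^sup>+v. ennreal (r v * std_normal_density (\<epsilon> * v)) \<partial>lborel) =
        (\<integral>\<^sup>+w. ennreal (r (w / \<epsilon>) * std_normal_density w) \<partial>lborel)"
      using that by (subst (2) nn_integral_real_affine[where c=\<epsilon> and t=0]) auto
    also have "\<dots> = ennreal (LBINT w. r (w / \<epsilon>) * std_normal_density w)"
      using ir r(2) by (intro nn_integral_eq_integral) auto
    also have "\<dots> = ennreal (LBINT x. b x * exp (- (2 * pi * x / \<epsilon>)\<^sup>2 / 2))"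
      using fourier_gaussian_parseval[OF b(1) r(1) that] by simp
    also have "\<dots> = ennreal (\<epsilon> / (2 * pi) * (LBINT z. b (\<epsilon> / (2 * pi) * z) * exp (- z\<^sup>2 / 2)))"
      using that by (subst lborel_integral_real_affine[where c="\<epsilon> / (2 * pi)" and t=0]) (auto simp: field_simps)
    also have "\<dots> = ennreal \<epsilon> * ennreal (1 / (2 * pi) * (LBINT z. b (\<epsilon> / (2 * pi) * z) * exp (- z\<^sup>2 / 2)))"
      using that by (subst ennreal_mult'[symmetric]) auto
    finally have "(\<integral>\<^sup>+v. ennreal (r v * std_normal_density (\<epsilon> * v)) \<partial>lborel) =
        ennreal (1 / (2 * pi) * (LBINT z. b (\<epsilon> / (2 * pi) * z) * exp (- z\<^sup>2 / 2)))"
      using that by (subst (asm) ennreal_mult_cancel_left) auto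
    \<comment> \<open>This factor removes the normalisation of the Gaussian on the left, and on the
      right it turns \<open>1 / (2 * pi)\<close> into exactly the normalisation of a standard normal
      density.\<close>
    then have "ennreal (sqrt (2 * pi)) * (\<integral>\<^sup>+v. ennreal (r v * std_normal_density (\<epsilon> * v)) \<partial>lborel) =
        ennreal (sqrt (2 * pi)) * ennreal (1 / (2 * pi) * (LBINT z. b (\<epsilon> / (2 * pi) * z) * exp (- z\<^sup>2 / 2)))"
      by simp
    also have "\<dots> = ennreal (LBINT z. b (\<epsilon> / (2 * pi) * z) * (exp (- z\<^sup>2 / 2) / sqrt (2 * pi)))"
    proof -
      have "sqrt (2 * pi) * (1 / (2 * pi) * I) = I / sqrt (2 * pi)" for I :: real
        by (simp add: field_simps)
      then show ?thesis
        by (simp add: ennreal_mult'[symmetric])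
    qed
    also have "ennreal (sqrt (2 * pi)) * (\<integral>\<^sup>+v. ennreal (r v * std_normal_density (\<epsilon> * v)) \<partial>lborel) =
        (\<integral>\<^sup>+v. ennreal (r v * exp (- (\<epsilon> * v)\<^sup>2 / 2)) \<partial>lborel)"
    proof (subst nn_integral_cmult[symmetric])
      show "(\<integral>\<^sup>+v. ennreal (sqrt (2 * pi)) * ennreal (r v * std_normal_density (\<epsilon> * v)) \<partial>lborel) =
        (\<integral>\<^sup>+v. ennreal (r v * exp (- (\<epsilon> * v)\<^sup>2 / 2)) \<partial>lborel)"
        by (intro nn_integral_cong) (simp add: ennreal_mult'[symmetric] normal_density_def)
    qed measurable
    finally show ?thesis by (simp add: normal_density_def mult.commute)
  qed
  define \<epsilon> where "\<epsilon> n = inverse (real (Suc n))" for n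
  have \<epsilon>: "0 < \<epsilon> n" for n by (simp add: \<epsilon>_def)
  have \<epsilon>0: "\<epsilon> \<longlonglongrightarrow> 0" unfolding \<epsilon>_def by (rule LIMSEQ_inverse_real_of_nat)
  have "(\<lambda>n. \<integral>\<^sup>+v. ennreal (r v * exp (- (\<epsilon> n * v)\<^sup>2 / 2)) \<partial>lborel) \<longlonglongrightarrow> (\<integral>\<^sup>+v. ennreal (r v) \<partial>lborel)"
  proof (rule nn_integral_LIMSEQ)
    show "incseq (\<lambda>n v. ennreal (r v * exp (- (\<epsilon> n * v)\<^sup>2 / 2)))"
      unfolding incseq_def le_fun_def
    proof (intro allI impI ennreal_leI mult_left_mono)
      fix m n :: nat and v :: real assume "m \<le> n"
      then have "\<epsilon> n \<le> \<epsilon> m" by (simp add: \<epsilon>_def divide_simps)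
      then have "(\<epsilon> n)\<^sup>2 \<le> (\<epsilon> m)\<^sup>2" using \<epsilon>[of n] by (intro power_mono) auto
      then show "exp (- (\<epsilon> m * v)\<^sup>2 / 2) \<le> exp (- (\<epsilon> n * v)\<^sup>2 / 2)"
        by (simp add: power_mult_distrib mult_right_mono)
    qed (rule r)
    show "(\<lambda>n. ennreal (r v * exp (- (\<epsilon> n * v)\<^sup>2 / 2))) \<longlonglongrightarrow> ennreal (r v)" for v
    proof (rule tendsto_ennrealI)
      have "(\<lambda>n. r v * exp (- (\<epsilon> n * v)\<^sup>2 / 2)) \<longlonglongrightarrow> r v * exp (- (0 * v)\<^sup>2 / 2)"
        by (intro tendsto_intros \<epsilon>0) simp
      then show "(\<lambda>n. r v * exp (- (\<epsilon> n * v)\<^sup>2 / 2)) \<longlonglongrightarrow> r v" by simp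
    qed
  qed measurable
  moreover have "(\<lambda>n. \<integral>\<^sup>+v. ennreal (r v * exp (- (\<epsilon> n * v)\<^sup>2 / 2)) \<partial>lborel) \<longlonglongrightarrow> ennreal (b 0)"
    unfolding key[OF \<epsilon>]
  proof (rule tendsto_ennrealI)
    \<comment> \<open>The right-hand sides are averages of \<open>b\<close> against Gaussians
      shrinking to 0, so continuity at 0 identifies their limit.\<close>
    have "(\<lambda>n. LBINT z. b (\<epsilon> n / (2 * pi) * z) * std_normal_density z) \<longlonglongrightarrow> (LBINT z. b 0 * std_normal_density z)"
    proof (rule integral_dominated_convergence)
      show "integrable lborel (\<lambda>z. B * std_normal_density z)"
        using integrable_std_normal_density by simp
      show "AE z in lborel. (\<lambda>n. b (\<epsilon> n / (2 * pi) * z) * std_normal_density z) \<longlonglongrightarrow> b 0 * std_normal_density z"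
      proof (intro AE_I2 tendsto_mult tendsto_const)
        fix z :: real
        have "(\<lambda>n. \<epsilon> n / (2 * pi) * z) \<longlonglongrightarrow> 0 / (2 * pi) * z"
          by (intro tendsto_intros \<epsilon>0) simp
        then have "(\<lambda>n. \<epsilon> n / (2 * pi) * z) \<longlonglongrightarrow> 0" by simp
        then show "(\<lambda>n. b (\<epsilon> n / (2 * pi) * z)) \<longlonglongrightarrow> b 0"
          using b(2) isCont_tendsto_compose by blast
      qed
      show "AE z in lborel. norm (b (\<epsilon> n / (2 * pi) * z) * std_normal_density z) \<le> B * std_normal_density z" for n
        using bounded_densityD(2)[OF b(1)] B by (intro AE_I2) (auto simp: abs_mult intro!: mult_right_mono)
    qed measurable
    moreover have "(LBINT z. std_normal_density z) = 1"
      using integral_normal_moment_even[of 1 0 0] by simp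
    ultimately show "(\<lambda>n. LBINT z. b (\<epsilon> n / (2 * pi) * z) * std_normal_density z) \<longlonglongrightarrow> b 0" by simp
  qed
  ultimately show ?thesis by (rule LIMSEQ_unique)
qed

section \<open>The kernel of a connection function\<close>

lemma integrable_exp_minus_abs:
  fixes c :: real
  assumes "0 < c"
  shows "integrable lborel (\<lambda>s. exp (- c * \<bar>s\<bar>))"
proof -
  have "(\<integral>\<^sup>+s. ennreal (exponential_density c s) \<partial>lborel) = 1"
    using prob_space.emeasure_space_1[OF prob_space_exponential_density[OF assms]]
    by (simp add: emeasure_density)
  then have i: "integrable lborel (exponential_density c)"
    using assms by (intro integrableI_nonneg) (auto simp: exponential_density_def)
  have "integrable lborel (\<lambda>s. exponential_density c (0 + (- 1) * s))"
    using i by (rule lborel_integrable_real_affine) simp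
  with i have "integrable lborel (\<lambda>s. (exponential_density c s + exponential_density c (- s)) / c)"
    by simp
  then show ?thesis
  proof (rule Bochner_Integration.integrable_bound)
    show "AE s in lborel. norm (exp (- c * \<bar>s\<bar>)) \<le> norm ((exponential_density c s + exponential_density c (- s)) / c)"
      using assms by (intro AE_I2) (auto simp: exponential_density_def abs_if field_simps)
  qed simp
qed

lemma bounded_density_if_exp_decay:
  assumes "a \<in> borel_measurable borel" "\<And>s. 0 \<le> a s" "\<And>s. a s \<le> M * exp (- c * \<bar>s\<bar>)" "0 < c"
  shows "bounded_density a"
proof -
  have "0 \<le> M" using assms(2,3)[of 0] by simp
  have "integrable lborel (\<lambda>s. M * exp (- c * \<bar>s\<bar>))"
    using integrable_exp_minus_abs[OF assms(4)] by simp
  then have "integrable lborel a"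
    by (rule Bochner_Integration.integrable_bound) (use assms in \<open>auto intro!: AE_I2 order_trans[OF assms(3)]\<close>)
  moreover have "a s \<le> M" for s
    using assms(3)[of s] \<open>0 \<le> M\<close> \<open>0 < c\<close> mult_left_mono[of "exp (- c * \<bar>s\<bar>)" 1 M] by simp
  ultimately show ?thesis using assms(2) unfolding bounded_density_def by blast
qed

locale connection_function =
  fixes \<tau> :: real and f :: "real \<Rightarrow> real"
  assumes tau: "2 < \<tau>" "\<tau> < 3"
    and cont: "continuous_on {0..} f"
    and mono: "mono_on {0..} f"
    and nonneg: "\<And>x. 0 \<le> x \<Longrightarrow> 0 \<le> f x"
    and lim_0: "((\<lambda>x. f x / x) \<longlongrightarrow> 1) (at_right 0)"
    and lim_infinity: "(f \<longlongrightarrow> 1) at_top"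
begin

lemma le_1: "0 \<le> x \<Longrightarrow> f x \<le> 1"
proof (rule tendsto_lowerbound[OF lim_infinity])
  show "0 \<le> x \<Longrightarrow> eventually (\<lambda>y. f x \<le> f y) at_top"
    using eventually_ge_at_top[of x] by eventually_elim (use mono in \<open>auto simp: mono_on_def\<close>)
qed simp

lemma near_0: "\<exists>\<delta>>0. \<forall>x. 0 < x \<longrightarrow> x < \<delta> \<longrightarrow> x / 2 \<le> f x \<and> f x \<le> 2 * x"
proof -
  have "eventually (\<lambda>x. dist (f x / x) 1 < 1 / 2) (at_right 0)"
    using tendstoD[OF lim_0, of "1 / 2"] by simp
  then obtain \<delta> where \<delta>: "\<delta> > 0" "\<And>x. 0 < x \<Longrightarrow> x < \<delta> \<Longrightarrow> dist (f x / x) 1 < 1 / 2"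
    unfolding eventually_at_right_field by auto
  have "x / 2 \<le> f x \<and> f x \<le> 2 * x" if "0 < x" "x < \<delta>" for x
  proof -
    have "\<bar>f x / x - 1\<bar> < 1 / 2" using \<delta>(2)[OF that] by (simp add: dist_real_def)
    then have "1 / 2 < f x / x" "f x / x < 2" by linarith+
    then show ?thesis using that(1) by (simp add: field_simps)
  qed
  then show ?thesis using \<delta>(1) by blast
qed

text \<open>The ratio limit gives positivity near 0 and monotonicity carries it to all larger
  arguments. It is the source of the nonvanishing of the limit constant.\<close>

lemma pos: "0 < x \<Longrightarrow> 0 < f x"
proof -
  assume "0 < x"
  obtain \<delta> where \<delta>: "\<delta> > 0" "\<And>x. 0 < x \<Longrightarrow> x < \<delta> \<Longrightarrow> x / 2 \<le> f x"
    using near_0 by blast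
  define y where "y = min x (\<delta> / 2)"
  have y: "0 < y" "y < \<delta>" "y \<le> x" using \<open>0 < x\<close> \<delta>(1) by (auto simp: y_def)
  have "0 < y / 2" using y by simp
  also have "\<dots> \<le> f y" using \<delta>(2) y by blast
  also have "\<dots> \<le> f x" using mono y by (auto simp: mono_on_def)
  finally show ?thesis .
qed

lemma le_linear: "\<exists>M\<ge>1. \<forall>x>0. f x \<le> M * x"
proof -
  obtain \<delta> where \<delta>: "\<delta> > 0" "\<And>x. 0 < x \<Longrightarrow> x < \<delta> \<Longrightarrow> f x \<le> 2 * x"
    using near_0 by blast
  \<comment> \<open>The value 2 serves the arguments below \<open>\<delta>\<close>; above,
    \<open>1 / \<delta>\<close> makes the linear function exceed 1, which already bounds
    \<open>f\<close>.\<close>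
  define M where "M = max 2 (1 / \<delta>)"
  have "f x \<le> M * x" if "0 < x" for x
  proof (cases "x < \<delta>")
    case True
    have "2 * x \<le> M * x" using that by (intro mult_right_mono) (auto simp: M_def)
    then show ?thesis using \<delta>(2)[OF that True] by linarith
  next
    case False
    then have "1 \<le> 1 / \<delta> * x" using \<delta>(1) by (simp add: field_simps)
    also have "\<dots> \<le> M * x" using that by (intro mult_right_mono) (auto simp: M_def)
    finally show ?thesis using le_1[of x] that by linarith
  qed
  moreover have "M \<ge> 1" by (simp add: M_def)
  ultimately show ?thesis by blast
qed

lemma measurable_extension: "(\<lambda>x. f (max 0 x)) \<in> borel_measurable borel"
  by (intro borel_measurable_continuous_onI continuous_on_compose2[OF cont] continuous_intros) auto

lemma continuous_log_kernel: "continuous_on UNIV (log_kernel \<tau> f)"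
  unfolding log_kernel_def[abs_def]
  by (intro continuous_intros continuous_on_compose2[OF cont]) auto

lemma log_kernel_pos: "0 < log_kernel \<tau> f s"
  unfolding log_kernel_def using pos[of "exp s"] by simp

text \<open>For negative \<open>s\<close> the linear bound on \<open>f\<close> gives the rate
  \<open>(3 - \<tau>) / 2\<close>; for positive \<open>s\<close> the bound 1 gives
  \<open>(\<tau> - 1) / 2\<close>, which is larger since \<open>\<tau> > 2\<close>. The smaller rate
  is used on both sides.\<close>

lemma log_kernel_decay: "\<exists>M. \<forall>s. log_kernel \<tau> f s \<le> M * exp (- ((3 - \<tau>) / 2) * \<bar>s\<bar>)"
proof -
  obtain M where M: "M \<ge> 1" "\<And>x. 0 < x \<Longrightarrow> f x \<le> M * x" using le_linear by blast
  have "log_kernel \<tau> f s \<le> M * exp (- ((3 - \<tau>) / 2) * \<bar>s\<bar>)" for s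
  proof (cases "0 \<le> s")
    case True
    have "log_kernel \<tau> f s \<le> exp (s * (1 - \<tau>) / 2) * 1"
      unfolding log_kernel_def by (intro mult_left_mono le_1) auto
    also have "\<dots> \<le> exp (- ((3 - \<tau>) / 2) * \<bar>s\<bar>)"
    proof -
      have "s * (1 - \<tau>) \<le> s * (\<tau> - 3)" using tau True by (intro mult_left_mono) auto
      moreover have "- ((3 - \<tau>) / 2) * \<bar>s\<bar> = s * (\<tau> - 3) / 2" using True by (simp add: field_simps)
      ultimately show ?thesis by simp
    qed
    also have "\<dots> \<le> M * exp (- ((3 - \<tau>) / 2) * \<bar>s\<bar>)" using M(1) by simp
    finally show ?thesis .
  next
    case False
    have "log_kernel \<tau> f s \<le> exp (s * (1 - \<tau>) / 2) * (M * exp s)"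
      unfolding log_kernel_def by (intro mult_left_mono M) auto
    also have "\<dots> = M * (exp (s * (1 - \<tau>) / 2) * exp s)" by simp
    also have "exp (s * (1 - \<tau>) / 2) * exp s = exp (- ((3 - \<tau>) / 2) * \<bar>s\<bar>)"
      using False by (simp add: exp_add[symmetric] field_simps)
    finally show ?thesis by simp
  qed
  then show ?thesis by blast
qed

lemma
  shows bounded_density_log_kernel: "bounded_density (log_kernel \<tau> f)"
    and bounded_density_weighted_log_kernel: "bounded_density (\<lambda>s. (1 + \<bar>s\<bar>) * log_kernel \<tau> f s)"
proof -
  have meas[measurable]: "log_kernel \<tau> f \<in> borel_measurable borel"
    by (rule borel_measurable_continuous_onI) (rule continuous_log_kernel)
  define c where "c = (3 - \<tau>) / 2"
  have c: "0 < c" using tau by (simp add: c_def)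
  obtain M where M: "log_kernel \<tau> f s \<le> M * exp (- c * \<bar>s\<bar>)" for s
    using log_kernel_decay unfolding c_def by blast
  have M0: "0 \<le> M" using M[of 0] log_kernel_pos[of 0] by simp
  show "bounded_density (log_kernel \<tau> f)"
    by (rule bounded_density_if_exp_decay[OF _ _ M c]) (auto intro: less_imp_le log_kernel_pos)
  show "bounded_density (\<lambda>s. (1 + \<bar>s\<bar>) * log_kernel \<tau> f s)"
  proof (rule bounded_density_if_exp_decay)
    fix s :: real
    \<comment> \<open>Half of the decay rate is spent on the linear weight:
      \<open>\<bar>s\<bar>\<close> is at most \<open>2 / c\<close> times this exponential, whence
      the constant \<open>1 + 2 / c\<close>.\<close>
    have e: "1 + c / 2 * \<bar>s\<bar> \<le> exp (c / 2 * \<bar>s\<bar>)" by (rule exp_ge_add_one_self)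
    have "1 + \<bar>s\<bar> \<le> 1 + c / 2 * \<bar>s\<bar> + 2 / c * (1 + c / 2 * \<bar>s\<bar>)"
      using c by (simp add: field_simps)
    also have "\<dots> = (1 + 2 / c) * (1 + c / 2 * \<bar>s\<bar>)" by (simp add: algebra_simps)
    also have "\<dots> \<le> (1 + 2 / c) * exp (c / 2 * \<bar>s\<bar>)" using c by (intro mult_left_mono e) auto
    finally have 1: "1 + \<bar>s\<bar> \<le> (1 + 2 / c) * exp (c / 2 * \<bar>s\<bar>)" .
    have "(1 + \<bar>s\<bar>) * log_kernel \<tau> f s \<le> ((1 + 2 / c) * exp (c / 2 * \<bar>s\<bar>)) * (M * exp (- c * \<bar>s\<bar>))"
      using 1 M log_kernel_pos[of s] c by (intro mult_mono) auto
    also have "\<dots> = ((1 + 2 / c) * M) * exp (c / 2 * \<bar>s\<bar> + - c * \<bar>s\<bar>)"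
      by (simp only: exp_add mult_ac)
    also have "c / 2 * \<bar>s\<bar> + - c * \<bar>s\<bar> = - (c / 2) * \<bar>s\<bar>" by (simp add: field_simps)
    finally show "(1 + \<bar>s\<bar>) * log_kernel \<tau> f s \<le> ((1 + 2 / c) * M) * exp (- (c / 2) * \<bar>s\<bar>)" .
  qed (use c log_kernel_pos in \<open>auto intro: less_imp_le\<close>)
qed

text \<open>Under \<open>x = exp s\<close> the Jacobian raises the exponent
  \<open>- (\<tau> + 1) / 2\<close> by 1 to \<open>(1 - \<tau>) / 2\<close>, the exponent of the
  kernel, and the imaginary power of \<open>x\<close> becomes a character in
  \<open>s\<close>.\<close>

lemma J_integral_eq_fourier: "J_integral \<tau> f v = fourier (log_kernel \<tau> f) v"
proof -
  define F where "F x = cis (- (2 * pi * v * ln x)) * of_real (x powr (- (\<tau> + 1) / 2) * f (max 0 x))" for x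
  note [measurable] = measurable_extension
  have F[measurable]: "F \<in> borel_measurable borel" unfolding F_def by measurable
  have "J_integral \<tau> f v = (LBINT x. indicator {0<..} x *\<^sub>R F x)"
    unfolding J_integral_def set_lebesgue_integral_def
  proof (intro Bochner_Integration.integral_cong refl)
    fix x :: real
    have "complex_of_real x powr (- 2 * complex_of_real pi * \<i> * complex_of_real v - complex_of_real ((\<tau> + 1) / 2))
        = cis (- (2 * pi * v * ln x)) * of_real (x powr (- (\<tau> + 1) / 2))" if "0 < x"
    proof -
      have "complex_of_real x powr (- 2 * complex_of_real pi * \<i> * complex_of_real v - complex_of_real ((\<tau> + 1) / 2))
          = exp ((- 2 * complex_of_real pi * \<i> * complex_of_real v - complex_of_real ((\<tau> + 1) / 2)) * of_real (ln x))"
        using that by (simp add: powr_def Ln_of_real)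
      also have "(- 2 * complex_of_real pi * \<i> * complex_of_real v - complex_of_real ((\<tau> + 1) / 2)) * of_real (ln x)
          = \<i> * of_real (- (2 * pi * v * ln x)) + of_real ((- (\<tau> + 1) / 2) * ln x)"
        by (simp add: field_simps)
      also have "exp \<dots> = cis (- (2 * pi * v * ln x)) * of_real (x powr (- (\<tau> + 1) / 2))"
        using that by (simp only: exp_add cis_conv_exp exp_of_real powr_def) simp
      finally show ?thesis .
    qed
    then show "indicat_real {0<..} x *\<^sub>R (complex_of_real x powr (- 2 * complex_of_real pi * \<i> * complex_of_real v
        - complex_of_real ((\<tau> + 1) / 2)) * complex_of_real (f x)) = indicat_real {0<..} x *\<^sub>R F x"
      by (cases "0 < x") (auto simp: F_def max_def mult.assoc)
  qed
  also have "\<dots> = (LINT x|density lborel (indicator {0<..}). F x)"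
    by (subst integral_density[symmetric]) (auto simp: ennreal_indicator)
  also have "\<dots> = (LBINT s. exp s *\<^sub>R F (exp s))"
    unfolding density_indicator_eq_distr_exp by (subst integral_distr) (auto simp: integral_density)
  also have "\<dots> = fourier (log_kernel \<tau> f) v"
    unfolding fourier_def
  proof (intro Bochner_Integration.integral_cong refl)
    fix s :: real
    have "exp s * exp (s * (- (\<tau> + 1) / 2)) = exp (s * (1 - \<tau>) / 2)"
      unfolding exp_add[symmetric] by (simp add: field_simps)
    moreover have "exp s powr (- (\<tau> + 1) / 2) = exp (s * (- (\<tau> + 1) / 2))"
      by (simp add: powr_def mult.commute)
    ultimately have "exp s * (exp s powr (- (\<tau> + 1) / 2) * f (max 0 (exp s))) = log_kernel \<tau> f s"
      by (simp add: log_kernel_def max_def flip: mult.assoc)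
    moreover have "exp s *\<^sub>R F (exp s) = cis (- (2 * pi * v * s)) *
        of_real (exp s * (exp s powr (- (\<tau> + 1) / 2) * f (max 0 (exp s))))"
      unfolding F_def by (simp add: scaleR_conv_of_real mult.left_commute)
    ultimately show "exp s *\<^sub>R F (exp s) = cis (- (2 * pi * v * s)) * of_real (log_kernel \<tau> f s)"
      by simp
  qed
  finally show ?thesis .
qed

text \<open>A vanishing integral of a nonnegative function would force it to vanish almost
  everywhere, but the integrand is nowhere zero. This makes the constant in the asymptotics
  nonzero.\<close>

lemma iterated_convolution_pos: "0 < iterated_convolution (log_kernel \<tau> f) (log_kernel \<tau> f) j x"
proof (induction j arbitrary: x)
  case 0
  then show ?case by (simp add: log_kernel_pos)
next
  case (Suc j)
  let ?g = "log_kernel \<tau> f"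
  have "0 < (LBINT z. iterated_convolution ?g ?g j z * ?g (z + x))"
  proof -
    have int: "integrable lborel (\<lambda>z. iterated_convolution ?g ?g j z * ?g (z + x))"
      by (intro integrable_convolution bounded_density_iterated_convolution bounded_density_log_kernel)
    have "(LBINT z. iterated_convolution ?g ?g j z * ?g (z + x)) \<noteq> 0"
    proof
      assume "(LBINT z. iterated_convolution ?g ?g j z * ?g (z + x)) = 0"
      then have "AE z in lborel. iterated_convolution ?g ?g j z * ?g (z + x) = 0"
        by (subst (asm) integral_nonneg_eq_0_iff_AE[OF int])
          (use Suc.IH log_kernel_pos in \<open>auto intro!: AE_I2 mult_nonneg_nonneg less_imp_le\<close>)
      moreover have "iterated_convolution ?g ?g j z * ?g (z + x) \<noteq> 0" for z
        using Suc.IH[of z] log_kernel_pos[of "z + x"] by simp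
      ultimately have "AE z in (lborel :: real measure). False" by simp
      then show False by (simp add: AE_iff_null null_sets_def emeasure_lborel_UNIV)
    qed
    moreover have "0 \<le> (LBINT z. iterated_convolution ?g ?g j z * ?g (z + x))"
      by (intro Bochner_Integration.integral_nonneg mult_nonneg_nonneg less_imp_le Suc.IH log_kernel_pos)
    ultimately show ?thesis by simp
  qed
  then show ?case by simp
qed

text \<open>The \<open>k - 1\<close> convolution steps combine \<open>k\<close> kernels. Since
  \<open>k - 1\<close> is odd, the transform is the nonnegative function
  \<open>\<bar>J\<bar> ^ k\<close>, and inversion at 0 applies.\<close>

lemma integral_J_power:
  assumes "even k" "2 \<le> k"
  shows "(LBINT v. cmod (J_integral \<tau> f v) ^ k) = iterated_convolution (log_kernel \<tau> f) (log_kernel \<tau> f) (k - 1) 0"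
proof -
  let ?g = "log_kernel \<tau> f"
  obtain m where k: "k = 2 * m + 2"
    using assms by (metis add.commute dvd_diff_nat even_numeral le_add_diff_inverse2 dvdE mult.commute)
  note [measurable] = borel_measurable_fourier[OF bounded_density_log_kernel]
  have k1: "k - 1 = Suc (2 * m)" using k by simp
  have "(\<integral>\<^sup>+v. ennreal (cmod (fourier ?g v) ^ k) \<partial>lborel) = ennreal (iterated_convolution ?g ?g (k - 1) 0)"
    unfolding k1
  proof (rule fourier_inversion_at_0)
    show "bounded_density (iterated_convolution ?g ?g (Suc (2 * m)))" by (intro bounded_density_iterated_convolution bounded_density_log_kernel)
    show "isCont (iterated_convolution ?g ?g (Suc (2 * m))) 0"
      by (rule isCont_iterated_convolution_Suc[OF bounded_density_log_kernel bounded_density_log_kernel continuous_log_kernel])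
  qed (use fourier_iterated_convolution_odd[OF bounded_density_log_kernel] k in auto)
  then have "(LBINT v. cmod (fourier ?g v) ^ k) = iterated_convolution ?g ?g (k - 1) 0"
    by (subst integral_eq_nn_integral) (auto simp: less_imp_le[OF iterated_convolution_pos])
  then show ?thesis by (simp add: J_integral_eq_fourier)
qed

end

section \<open>Counting cycles\<close>

text \<open>Positions on a cycle are treated as residues modulo \<open>k\<close>, so that arguments
  about neighbours are congruences without a special case at the ends of the list.\<close>

lemma nth_mod_length_eq_iff:
  assumes "distinct vs" "length vs = k" "0 < k"
  shows "vs ! (a mod k) = vs ! (b mod k) \<longleftrightarrow> [a = b] (mod k)"
  using assms by (simp add: nth_eq_iff_index_eq cong_def)

lemma cycle_edges_eq_range:
  assumes "length vs = k" "0 < k"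
  shows "cycle_edges vs = range (\<lambda>i. {vs ! (i mod k), vs ! (Suc i mod k)})"
proof -
  have "{vs ! (i mod k), vs ! (Suc i mod k)} \<in> cycle_edges vs" for i
    using assms unfolding cycle_edges_def by (auto intro!: exI[of _ "i mod k"] simp: mod_Suc_eq)
  moreover have "cycle_edges vs \<subseteq> range (\<lambda>i. {vs ! (i mod k), vs ! (Suc i mod k)})"
    using assms unfolding cycle_edges_def by (force simp: image_iff)
  ultimately show ?thesis by blast
qed

lemma Union_cycle_edges:
  assumes "length vs = k" "0 < k"
  shows "\<Union> (cycle_edges vs) = set vs"
proof -
  have "\<Union> (cycle_edges vs) = range (\<lambda>i. vs ! (i mod k))"
    unfolding cycle_edges_eq_range[OF assms] by auto
  also have "\<dots> = set vs"
  proof (intro antisym subsetI)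
    fix x assume "x \<in> set vs"
    then obtain i where "i < k" "x = vs ! i" using assms by (auto simp: in_set_conv_nth)
    then have "x = vs ! (i mod k)" by simp
    then show "x \<in> range (\<lambda>i. vs ! (i mod k))" by blast
  qed (use assms in auto)
  finally show ?thesis .
qed

text \<open>Two positions with the same edge either coincide or traverse it in opposite directions.
  The latter would make 2 divisible by \<open>k\<close>, which \<open>k \<ge> 3\<close>
  excludes.\<close>

lemma inj_on_cycle_edge:
  assumes "distinct vs" "length vs = k" "3 \<le> k"
  shows "inj_on (\<lambda>i. {vs ! i, vs ! (Suc i mod k)}) {..<k}"
proof (rule inj_onI)
  fix i j assume ij: "i \<in> {..<k}" "j \<in> {..<k}" and eq: "{vs ! i, vs ! (Suc i mod k)} = {vs ! j, vs ! (Suc j mod k)}"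
  note iff = nth_mod_length_eq_iff[OF assms(1,2)]
  have k: "0 < k" using assms by simp
  have mods: "i mod k = i" "j mod k = j" using ij by auto
  have "\<not> ([i = Suc j] (mod k) \<and> [Suc i = j] (mod k))"
  proof
    assume a: "[i = Suc j] (mod k) \<and> [Suc i = j] (mod k)"
    have "[Suc (Suc j) = j] (mod k)"
      using a by (metis cong_trans cong_sym cong_add_lcancel_nat plus_1_eq_Suc)
    then have "[2 = 0] (mod k)"
      by (metis add_2_eq_Suc' add_cancel_right_right cong_add_lcancel_nat)
    then show False using assms(3) by (simp add: cong_def)
  qed
  then show "i = j"
    using eq iff[OF k, of i j] iff[OF k, of i "Suc j"] iff[OF k, of "Suc i" j] mods ij
    by (auto simp: doubleton_eq_iff cong_def)
qed

lemma card_cycle_edges: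
  assumes "distinct vs" "length vs = k" "3 \<le> k"
  shows "card (cycle_edges vs) = k"
proof -
  have "cycle_edges vs = (\<lambda>i. {vs ! i, vs ! (Suc i mod k)}) ` {..<k}"
    using assms by (auto simp: cycle_edges_def)
  then show ?thesis using card_image[OF inj_on_cycle_edge[OF assms]] by simp
qed

text \<open>
  The rotations (\<open>d = 1\<close>) and reflections (\<open>d = k - 1\<close>, that is, \<open>-1\<close> modulo \<open>k\<close>) of a cyclic sequence.
\<close>

definition cycle_reparam :: "nat list \<Rightarrow> nat \<times> nat \<Rightarrow> nat list" where
  "cycle_reparam vs = (\<lambda>(r, d). map (\<lambda>i. vs ! ((r + d * i) mod length vs)) [0..<length vs])"

text \<open>The fibre is an orbit of the dihedral group. A list tracing the given cycle is
  determined by its first vertex and the direction of its first step, because it can never turn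
  back.\<close>

lemma cycle_edges_fibre:
  assumes vs: "distinct vs" "length vs = k" and k: "3 \<le> k"
  shows "{ws. length ws = k \<and> distinct ws \<and> cycle_edges ws = cycle_edges vs}
    = cycle_reparam vs ` ({..<k} \<times> {1, k - 1})"
proof (intro antisym subsetI)
  have k0: "0 < k" using k by simp
  note iff = nth_mod_length_eq_iff[OF vs k0]
  note range = cycle_edges_eq_range[OF vs(2) k0]
  {
    fix ws assume "ws \<in> {ws. length ws = k \<and> distinct ws \<and> cycle_edges ws = cycle_edges vs}"
    then have ws: "length ws = k" "distinct ws" "cycle_edges ws = cycle_edges vs" by auto
    note iff' = nth_mod_length_eq_iff[OF ws(2,1) k0]
    have nbr: "x = vs ! (Suc a mod k) \<or> x = vs ! ((a + (k - 1)) mod k)"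
      if edge: "{vs ! (a mod k), x} \<in> cycle_edges vs" for a x
    proof -
      obtain j where j: "{vs ! (a mod k), x} = {vs ! (j mod k), vs ! (Suc j mod k)}"
        using edge unfolding range by auto
      then consider "vs ! (a mod k) = vs ! (j mod k)" "x = vs ! (Suc j mod k)"
        | "vs ! (a mod k) = vs ! (Suc j mod k)" "x = vs ! (j mod k)"
        by (auto simp: doubleton_eq_iff)
      then show ?thesis
      proof cases
        case 1
        then have "[a = j] (mod k)" using iff by simp
        then have "[Suc a = Suc j] (mod k)" using cong_add_lcancel_nat[of 1 a j k] by simp
        then show ?thesis using 1 by (simp add: cong_def)
      next
        case 2
        then have "[a = Suc j] (mod k)" using iff by blast
        then have "[a + (k - 1) = Suc j + (k - 1)] (mod k)" by (rule cong_add[OF _ cong_refl])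
        moreover have "Suc j + (k - 1) = j + k" using k by simp
        ultimately have "(a + (k - 1)) mod k = j mod k" by (simp add: cong_def)
        then show ?thesis using 2 by simp
      qed
    qed
    have "set ws = set vs" using Union_cycle_edges[OF ws(1) k0] Union_cycle_edges[OF vs(2) k0] ws(3) by simp
    then have "ws ! 0 \<in> set vs" using ws(1) k0 by (metis nth_mem)
    then obtain r where r: "r < k" "ws ! 0 = vs ! r" using vs by (metis in_set_conv_nth)
    have edge: "{ws ! (i mod k), ws ! (Suc i mod k)} \<in> cycle_edges vs" for i
      unfolding ws(3)[symmetric] cycle_edges_eq_range[OF ws(1) k0] by blast
    have "ws ! (1 mod k) = vs ! (Suc r mod k) \<or> ws ! (1 mod k) = vs ! ((r + (k - 1)) mod k)"
      using edge[of 0] r by (intro nbr) simp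
    then have "\<exists>d. (d = 1 \<or> d = k - 1) \<and> ws ! (1 mod k) = vs ! ((r + d) mod k)"
      by (metis Suc_eq_plus1)
    then obtain d where d: "d = 1 \<or> d = k - 1" "ws ! (1 mod k) = vs ! ((r + d) mod k)" by blast
    have nbr': "x = vs ! ((a + d) mod k) \<or> x = vs ! ((a + (k - d)) mod k)"
      if "{vs ! (a mod k), x} \<in> cycle_edges vs" for a x
      using nbr[OF that] d(1) k by auto
    \<comment> \<open>Two consecutive positions are carried through the induction, since the
      previous vertex is needed to exclude turning back.\<close>
    have "ws ! (i mod k) = vs ! ((r + d * i) mod k) \<and> ws ! (Suc i mod k) = vs ! ((r + d * Suc i) mod k)" for i
    proof (induction i)
      case 0
      then show ?case using r d(2) by simp
    next
      case (Suc i)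
      have "{vs ! ((r + d * Suc i) mod k), ws ! (Suc (Suc i) mod k)} \<in> cycle_edges vs"
        using edge[of "Suc i"] Suc.IH by simp
      from nbr'[OF this] have "ws ! (Suc (Suc i) mod k) = vs ! ((r + d * Suc (Suc i)) mod k)"
      proof
        \<comment> \<open>Turning back would repeat the vertex two positions earlier, contradicting
          distinctness for \<open>k \<ge> 3\<close>.\<close>
        assume "ws ! (Suc (Suc i) mod k) = vs ! ((r + d * Suc i + (k - d)) mod k)"
        moreover have "r + d * Suc i + (k - d) = r + d * i + k" using d(1) k by auto
        moreover have "(r + d * i + k) mod k = (r + d * i) mod k" by (rule mod_add_self2)
        ultimately have "ws ! (Suc (Suc i) mod k) = ws ! (i mod k)" using Suc.IH by metis
        then have "[Suc (Suc i) = i] (mod k)" using iff' by blast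
        then have "[2 = 0] (mod k)"
          by (metis add_2_eq_Suc' add_cancel_right_right cong_add_lcancel_nat)
        then show ?thesis using k by (simp add: cong_def)
      qed (simp add: algebra_simps)
      then show ?case using Suc.IH by simp
    qed
    then have "ws ! i = vs ! ((r + d * i) mod k)" if "i < k" for i using that by (metis mod_less)
    then have "ws = cycle_reparam vs (r, d)"
      using ws(1) vs(2) by (auto simp: cycle_reparam_def intro!: nth_equalityI)
    then show "ws \<in> cycle_reparam vs ` ({..<k} \<times> {1, k - 1})"
      using r d(1) by auto
  next
    fix ws assume "ws \<in> cycle_reparam vs ` ({..<k} \<times> {1, k - 1})"
    then obtain r d where rd: "r < k" "d = 1 \<or> d = k - 1" "ws = cycle_reparam vs (r, d)" by auto
    have len: "length ws = k" using rd vs by (simp add: cycle_reparam_def)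
    have nth: "ws ! i = vs ! ((r + d * i) mod k)" if "i < k" for i
      using rd vs that by (simp add: cycle_reparam_def)
    have nth_mod: "ws ! (i mod k) = vs ! ((r + d * i) mod k)" for i
    proof -
      have "[i mod k = i] (mod k)" by (simp add: cong_def)
      then have "[r + d * (i mod k) = r + d * i] (mod k)" by (intro cong_add cong_mult cong_refl)
      then show ?thesis using nth[of "i mod k"] k0 iff by simp
    qed
    \<comment> \<open>Multiplication by a unit modulo \<open>k\<close> is injective on residues, so
      the reparametrised list stays distinct.\<close>
    have cop: "coprime d k" using rd(2) k0 coprime_diff_one_left_nat[OF k0] by auto
    have dist: "distinct ws"
    proof (subst distinct_conv_nth, intro allI impI notI)
      fix i j assume ij: "i < length ws" "j < length ws" "i \<noteq> j" "ws ! i = ws ! j"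
      then have "[r + d * i = r + d * j] (mod k)" using nth len iff by simp
      then have "[d * i = d * j] (mod k)" by (simp add: cong_add_lcancel_nat)
      then have "[i = j] (mod k)" using cop by (simp add: cong_mult_lcancel_nat)
      then show False using ij len by (simp add: cong_def)
    qed
    have "cycle_edges ws \<subseteq> cycle_edges vs"
    proof
      fix e assume "e \<in> cycle_edges ws"
      then obtain i where i: "e = {ws ! (i mod k), ws ! (Suc i mod k)}"
        unfolding cycle_edges_eq_range[OF len k0] by auto
      define m where "m = r + d * i"
      have e: "e = {vs ! (m mod k), vs ! ((m + d) mod k)}"
        unfolding i nth_mod m_def by (simp add: algebra_simps)
      show "e \<in> cycle_edges vs"
        using rd(2)
      proof
        assume "d = 1"
        then show ?thesis unfolding e range by auto
      next
        assume d: "d = k - 1"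
        have "Suc (m + d) = m + k" using d k by simp
        then have "m mod k = Suc (m + d) mod k" by (simp only: mod_add_self2)
        then show ?thesis unfolding e range by (auto simp: insert_commute)
      qed
    qed
    \<comment> \<open>Both edge sets have \<open>k\<close> elements, so the inclusion just shown is
      an equality.\<close>
    moreover have "finite (cycle_edges vs)" using card_cycle_edges[OF vs k] k0 card_ge_0_finite by auto
    ultimately have "cycle_edges ws = cycle_edges vs"
      using card_cycle_edges[OF vs k] card_cycle_edges[OF dist len k] by (intro card_subset_eq) auto
    then show "ws \<in> {ws. length ws = k \<and> distinct ws \<and> cycle_edges ws = cycle_edges vs}"
      using len dist by simp
  }
qed

text \<open>Position 0 of the list recovers \<open>r\<close> and position 1 then recovers
  \<open>d\<close>; the two directions \<open>1\<close> and \<open>k - 1\<close> differ because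
  \<open>k \<ge> 3\<close>.\<close>

lemma card_cycle_edges_fibre:
  assumes vs: "distinct vs" "length vs = k" and k: "3 \<le> k"
  shows "card {ws. length ws = k \<and> distinct ws \<and> cycle_edges ws = cycle_edges vs} = 2 * k"
proof -
  have k0: "0 < k" using k by simp
  note iff = nth_mod_length_eq_iff[OF vs k0]
  have "inj_on (cycle_reparam vs) ({..<k} \<times> {1, k - 1})"
  proof (rule inj_onI)
    fix x y assume xy: "x \<in> {..<k} \<times> {1, k - 1}" "y \<in> {..<k} \<times> {1, k - 1}"
      and eq0: "cycle_reparam vs x = cycle_reparam vs y"
    obtain r d r' d' where rd: "x = (r, d)" "y = (r', d')" by (cases x, cases y)
    have r: "r \<in> {..<k}" "r' \<in> {..<k}" and d: "d \<in> {1, k - 1}" "d' \<in> {1, k - 1}"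
      using xy by (simp_all only: rd mem_Sigma_iff)
    have eq: "cycle_reparam vs (r, d) = cycle_reparam vs (r', d')" using eq0 rd by simp
    have eq': "[r + d * i = r' + d' * i] (mod k)" if "i < k" for i
    proof -
      have "vs ! ((r + d * i) mod k) = vs ! ((r' + d' * i) mod k)"
        using arg_cong[OF eq, of "\<lambda>xs. xs ! i"] that vs(2) by (simp add: cycle_reparam_def)
      then show ?thesis by (simp only: iff)
    qed
    have "r = r'" using eq'[of 0] r k0 by (simp add: cong_def)
    moreover have "[d = d'] (mod k)" using eq'[of 1] k \<open>r = r'\<close> by (simp add: cong_add_lcancel_nat)
    moreover have "d < k" "d' < k" using d k by auto
    ultimately show "x = y" by (simp add: cong_def rd)
  qed
  then have "card (cycle_reparam vs ` ({..<k} \<times> {1, k - 1})) = k * card {1, k - 1}"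
    by (subst card_image) (auto simp: card_cartesian_product)
  also have "card {1, k - 1} = 2" using k by (simp add: card_insert_if)
  finally show ?thesis unfolding cycle_edges_fibre[OF assms] by simp
qed

section \<open>The number of cycles on a vertex set\<close>

definition cycles_on :: "nat \<Rightarrow> nat set \<Rightarrow> nat set set set" where
  "cycles_on k V = cycle_edges ` {vs. length vs = k \<and> distinct vs \<and> set vs \<subseteq> V}"

lemma finite_distinct_lists: "finite V \<Longrightarrow> finite {vs. length vs = k \<and> distinct vs \<and> set vs \<subseteq> V}"
  by (rule finite_subset[OF _ finite_lists_length_eq[of V k]]) auto

lemma finite_cycles_on: "finite V \<Longrightarrow> finite (cycles_on k V)"
  unfolding cycles_on_def by (intro finite_imageI finite_distinct_lists)

text \<open>Double counting of the lists of \<open>k\<close> distinct vertices, grouped by the cycle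
  they trace: every group has \<open>2 * k\<close> members.\<close>

lemma card_cycles_on:
  assumes "finite V" "3 \<le> k" "k \<le> card V"
  shows "2 * k * card (cycles_on k V) = (card V choose k) * fact k"
proof -
  let ?D = "{vs. length vs = k \<and> distinct vs \<and> set vs \<subseteq> V}"
  have "card ?D = (\<Sum>vs\<in>?D. 1)" by simp
  also have "\<dots> = (\<Sum>C\<in>cycles_on k V. \<Sum>vs\<in>{vs. vs \<in> ?D \<and> cycle_edges vs = C}. 1)"
    unfolding cycles_on_def by (rule sum.image_gen[OF finite_distinct_lists[OF assms(1)]])
  also have "\<dots> = (\<Sum>C\<in>cycles_on k V. 2 * k)"
  proof (rule sum.cong[OF refl])
    fix C assume "C \<in> cycles_on k V"
    then obtain vs where vs: "length vs = k" "distinct vs" "set vs \<subseteq> V" "C = cycle_edges vs"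
      by (auto simp: cycles_on_def)
    \<comment> \<open>A cycle determines its vertex set, so every list tracing it stays inside
      \<open>V\<close>, and the restriction to \<open>V\<close> leaves the fibre intact.\<close>
    have "set ws = set vs" if "length ws = k" "cycle_edges ws = cycle_edges vs" for ws
    proof -
      have "0 < k" using assms(2) by simp
      then show ?thesis using Union_cycle_edges[OF that(1)] Union_cycle_edges[OF vs(1)] that(2) by metis
    qed
    then have "{ws. ws \<in> ?D \<and> cycle_edges ws = C} = {ws. length ws = k \<and> distinct ws \<and> cycle_edges ws = cycle_edges vs}"
      unfolding vs(4) mem_Collect_eq using vs(3) by metis
    then show "(\<Sum>vs\<in>{vs. vs \<in> ?D \<and> cycle_edges vs = C}. 1) = 2 * k"
      using card_cycle_edges_fibre[OF vs(2,1) assms(2)] by (simp only: flip: card_eq_sum)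
  qed
  finally have "2 * k * card (cycles_on k V) = card ?D" by simp
  also have "\<dots> = \<Prod>{card V - k + 1..card V}"
    by (rule card_lists_distinct_length_eq[OF assms(1,3)])
  also have "\<dots> = fact (card V) div fact (card V - k)"
    using fact_div_fact[of "card V - k" "card V"] by simp
  also have "\<dots> = (card V choose k) * fact k"
    using binomial_fact_lemma[OF assms(3)] by (metis div_mult_self1_is_m fact_gt_zero mult.commute mult.left_commute)
  finally show ?thesis .
qed

section \<open>Cycles as events about edge indicators\<close>

definition edges_of :: "nat \<Rightarrow> (nat \<times> nat \<Rightarrow> bool) \<Rightarrow> nat set set" where
  "edges_of n b = {{i, j} | i j. (i, j) \<in> vertex_pairs n \<and> b (i, j)}"

lemma finite_vertex_pairs [simp]: "finite (vertex_pairs n)"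
  by (rule finite_subset[of _ "{1..n} \<times> {1..n}"]) (auto simp: vertex_pairs_def)

text \<open>\<open>num_cycles\<close> does not mention the vertex set, but all vertices of a cycle
  are endpoints of edges of the graph and hence lie in \<open>{1..n}\<close>.\<close>

lemma num_cycles_edges_of:
  assumes "0 < k"
  shows "num_cycles k (edges_of n b) = card {C \<in> cycles_on k {1..n}. C \<subseteq> edges_of n b}"
proof -
  have "set vs \<subseteq> {1..n}" if "length vs = k" "cycle_edges vs \<subseteq> edges_of n b" for vs
  proof -
    have "\<Union> (edges_of n b) \<subseteq> {1..n}" by (auto simp: edges_of_def vertex_pairs_def)
    then show ?thesis using Union_cycle_edges[OF that(1) assms] that(2) by blast
  qed
  then have "{C. C \<subseteq> edges_of n b \<and> (\<exists>vs. length vs = k \<and> distinct vs \<and> C = cycle_edges vs)}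
      = {C \<in> cycles_on k {1..n}. C \<subseteq> edges_of n b}"
    unfolding cycles_on_def by blast
  then show ?thesis unfolding num_cycles_def by simp
qed

text \<open>The coordinates of the indicator family on which the presence of \<open>C\<close>
  depends.\<close>

definition cycle_pairs :: "nat \<Rightarrow> nat set set \<Rightarrow> (nat \<times> nat) set" where
  "cycle_pairs n C = {x \<in> vertex_pairs n. {fst x, snd x} \<in> C}"

text \<open>Sorting the endpoints of each edge matches list positions with indicator coordinates.
  This converts the product given by independence into a product around the cycle.\<close>

lemma bij_betw_cycle_pairs:
  assumes vs: "distinct vs" "length vs = k" "set vs \<subseteq> {1..n}" and k: "3 \<le> k"
  shows "bij_betw (\<lambda>i. (min (vs ! i) (vs ! (Suc i mod k)), max (vs ! i) (vs ! (Suc i mod k))))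
    {..<k} (cycle_pairs n (cycle_edges vs))"
  unfolding bij_betw_def
proof
  let ?e = "\<lambda>i. (min (vs ! i) (vs ! (Suc i mod k)), max (vs ! i) (vs ! (Suc i mod k)))"
  have k0: "0 < k" using k by simp
  have e: "{fst (?e i), snd (?e i)} = {vs ! i, vs ! (Suc i mod k)}" for i
    by (auto simp: min_def max_def)
  show "inj_on ?e {..<k}"
    by (rule inj_onI, rule inj_onD[OF inj_on_cycle_edge[OF vs(1,2) k]]) (metis e, auto)
  have "?e i \<in> cycle_pairs n (cycle_edges vs)" if "i < k" for i
  proof -
    have "i \<noteq> Suc i mod k" using that k by (auto simp: mod_Suc split: if_splits)
    then have "vs ! i \<noteq> vs ! (Suc i mod k)" using that vs k0 by (simp add: nth_eq_iff_index_eq)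
    moreover have "vs ! i \<in> {1..n}" "vs ! (Suc i mod k) \<in> {1..n}"
      using vs that k0 by (auto simp: subset_iff)
    moreover have "{vs ! i, vs ! (Suc i mod k)} \<in> cycle_edges vs"
      using that vs(2) by (auto simp: cycle_edges_def)
    ultimately show ?thesis unfolding cycle_pairs_def mem_Collect_eq e
      by (auto simp: vertex_pairs_def min_def max_def)
  qed
  moreover have "x \<in> ?e ` {..<k}" if "x \<in> cycle_pairs n (cycle_edges vs)" for x
  proof -
    obtain i j where x: "x = (i, j)" by (cases x)
    with that have ij: "i < j" "{i, j} \<in> cycle_edges vs" by (auto simp: cycle_pairs_def vertex_pairs_def)
    then obtain m where m: "m < k" "{i, j} = {vs ! m, vs ! (Suc m mod k)}"
      using vs(2) by (auto simp: cycle_edges_def)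
    then have "x = ?e m" using ij(1) x by (auto simp: doubleton_eq_iff min_def max_def)
    then show ?thesis using m(1) by blast
  qed
  ultimately show "?e ` {..<k} = cycle_pairs n (cycle_edges vs)" by blast
qed

lemma cycle_subset_edges_of_iff:
  assumes vs: "distinct vs" "length vs = k" "set vs \<subseteq> {1..n}" and k: "3 \<le> k"
  shows "cycle_edges vs \<subseteq> edges_of n b \<longleftrightarrow> (\<forall>x\<in>cycle_pairs n (cycle_edges vs). b x)"
proof
  assume sub: "cycle_edges vs \<subseteq> edges_of n b"
  show "\<forall>x\<in>cycle_pairs n (cycle_edges vs). b x"
  proof
    fix x assume x: "x \<in> cycle_pairs n (cycle_edges vs)"
    then have "{fst x, snd x} \<in> edges_of n b" "fst x < snd x"
      using sub by (auto simp: cycle_pairs_def vertex_pairs_def)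
    then obtain i j where "{fst x, snd x} = {i, j}" "i < j" "b (i, j)"
      by (auto simp: edges_of_def vertex_pairs_def)
    moreover from this \<open>fst x < snd x\<close> have "x = (i, j)" by (cases x) (auto simp: doubleton_eq_iff)
    ultimately show "b x" by simp
  qed
next
  let ?e = "\<lambda>i. (min (vs ! i) (vs ! (Suc i mod k)), max (vs ! i) (vs ! (Suc i mod k)))"
  assume all: "\<forall>x\<in>cycle_pairs n (cycle_edges vs). b x"
  show "cycle_edges vs \<subseteq> edges_of n b"
  proof
    fix C assume "C \<in> cycle_edges vs"
    then obtain i where i: "i < k" "C = {vs ! i, vs ! (Suc i mod k)}"
      using vs(2) by (auto simp: cycle_edges_def)
    have "?e i \<in> cycle_pairs n (cycle_edges vs)"
      using bij_betw_cycle_pairs[OF assms] i(1) by (auto simp: bij_betw_def)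
    then have "?e i \<in> vertex_pairs n" "b (?e i)" using all by (auto simp: cycle_pairs_def)
    moreover have "C = {fst (?e i), snd (?e i)}" using i(2) by (auto simp: min_def max_def)
    ultimately show "C \<in> edges_of n b" unfolding edges_of_def by auto
  qed
qed

section \<open>Cycle counts in random graphs with random weights\<close>

locale edge_kernel = prob_space W for W :: "real measure" +
  fixes p :: "real \<Rightarrow> real \<Rightarrow> real"
  assumes p_bounds: "\<And>x y. x \<in> space W \<Longrightarrow> y \<in> space W \<Longrightarrow> 0 \<le> p x y \<and> p x y \<le> 1"
    and p_sym: "\<And>x y. p x y = p y x"
    and p_measurable: "(\<lambda>(x, y). p x y) \<in> borel_measurable (W \<Otimes>\<^sub>M W)"
begin

lemma p_component_measurable:
  assumes "i \<in> I" "j \<in> I"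
  shows "(\<lambda>h. p (h i) (h j)) \<in> borel_measurable (PiM I (\<lambda>_. W))"
proof -
  have "(\<lambda>h. (h i, h j)) \<in> PiM I (\<lambda>_. W) \<rightarrow>\<^sub>M W \<Otimes>\<^sub>M W"
    using assms by (intro measurable_Pair measurable_component_singleton)
  from measurable_compose[OF this p_measurable] show ?thesis by simp
qed

lemma p_component_bounds:
  assumes "h \<in> space (PiM I (\<lambda>_. W))" "i \<in> I" "j \<in> I"
  shows "0 \<le> p (h i) (h j)" "p (h i) (h j) \<le> 1"
  using assms p_bounds[of "h i" "h j"] by (auto simp: space_PiM PiE_iff)

abbreviation edge_indicators :: "nat \<Rightarrow> (nat \<Rightarrow> real) \<Rightarrow> (nat \<times> nat \<Rightarrow> bool) pmf" where
  "edge_indicators n h \<equiv> Pi_pmf (vertex_pairs n) False (\<lambda>(i, j). bernoulli_pmf (p (h i) (h j)))"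

lemma graph_given_weights_eq: "graph_given_weights p n h = map_pmf (edges_of n) (edge_indicators n h)"
  by (simp add: graph_given_weights_def edges_of_def[abs_def])

lemma vertex_pairsD: "(i, j) \<in> vertex_pairs n \<Longrightarrow> i \<in> {1..n} \<and> j \<in> {1..n}"
  by (auto simp: vertex_pairs_def)

text \<open>For fixed \<open>n\<close> there are finitely many indicator configurations, so the
  probability of any set of graphs is a finite sum of products of measurable functions of the
  weights.\<close>

lemma measurable_graph_given_weights:
  "(\<lambda>h. measure_pmf (graph_given_weights p n h)) \<in>
     PiM {1..n} (\<lambda>_. W) \<rightarrow>\<^sub>M subprob_algebra (count_space UNIV)"
proof (rule measurable_subprob_algebra)
  fix A :: "nat set set set"
  \<comment> \<open>The default value \<open>False\<close> outside \<open>vertex_pairs n\<close>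
    leaves finitely many configurations that can carry mass.\<close>
  define S where "S = PiE_dflt (vertex_pairs n) False (\<lambda>_. UNIV :: bool set) \<inter> edges_of n -` A"
  have "finite S" unfolding S_def by (intro finite_Int disjI1 finite_PiE_dflt) auto
  have eq: "emeasure (graph_given_weights p n h) A = (\<Sum>b\<in>S. ennreal (pmf (edge_indicators n h) b))" for h
  proof -
    have "emeasure (graph_given_weights p n h) A = emeasure (edge_indicators n h) (edges_of n -` A)"
      by (simp add: graph_given_weights_eq)
    also have "\<dots> = emeasure (edge_indicators n h) S"
    proof (rule emeasure_eq_AE)
      show "AE b in edge_indicators n h. b \<in> edges_of n -` A \<longleftrightarrow> b \<in> S"
      proof (rule AE_pmfI)
        fix b assume "b \<in> set_pmf (edge_indicators n h)"
        then have "b \<in> PiE_dflt (vertex_pairs n) False (\<lambda>_. UNIV)"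
          using set_Pi_pmf_subset[of "vertex_pairs n" False] by (auto simp: PiE_dflt_def)
        then show "b \<in> edges_of n -` A \<longleftrightarrow> b \<in> S" by (simp add: S_def)
      qed
    qed auto
    also have "\<dots> = (\<Sum>b\<in>S. ennreal (pmf (edge_indicators n h) b))"
      using \<open>finite S\<close> by (simp add: emeasure_measure_pmf_finite)
    finally show ?thesis .
  qed
  have "(\<lambda>h. pmf (edge_indicators n h) b) \<in> borel_measurable (PiM {1..n} (\<lambda>_. W))" if "b \<in> S" for b
  proof -
    have b: "\<forall>x. x \<notin> vertex_pairs n \<longrightarrow> b x = False" using that by (auto simp: S_def PiE_dflt_def)
    have "(\<lambda>h. \<Prod>(i, j)\<in>vertex_pairs n. if b (i, j) then p (h i) (h j) else 1 - p (h i) (h j))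
        \<in> borel_measurable (PiM {1..n} (\<lambda>_. W))"
    proof (rule borel_measurable_prod)
      fix x assume x: "x \<in> vertex_pairs n"
      obtain i j where "x = (i, j)" by (cases x)
      then show "(\<lambda>h. case x of (i, j) \<Rightarrow> if b (i, j) then p (h i) (h j) else 1 - p (h i) (h j))
        \<in> borel_measurable (PiM {1..n} (\<lambda>_. W))"
        using p_component_measurable[of i "{1..n}" j] vertex_pairsD[of i j n] x by auto
    qed
    moreover have eqn: "pmf (edge_indicators n h) b =
        (\<Prod>(i, j)\<in>vertex_pairs n. if b (i, j) then p (h i) (h j) else 1 - p (h i) (h j))"
      if h: "h \<in> space (PiM {1..n} (\<lambda>_. W))" for h
    proof -
      have "pmf (edge_indicators n h) b = (\<Prod>x\<in>vertex_pairs n. pmf (case x of (i, j) \<Rightarrow> bernoulli_pmf (p (h i) (h j))) (b x))"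
        using b by (subst pmf_Pi') auto
      also have "\<dots> = (\<Prod>(i, j)\<in>vertex_pairs n. if b (i, j) then p (h i) (h j) else 1 - p (h i) (h j))"
      proof (rule prod.cong[OF refl])
        fix x assume x: "x \<in> vertex_pairs n"
        obtain i j where ij: "x = (i, j)" by (cases x)
        have "0 \<le> p (h i) (h j)" "p (h i) (h j) \<le> 1"
          using p_component_bounds[OF h, of i j] vertex_pairsD[of i j n] x ij by auto
        then show "pmf (case x of (i, j) \<Rightarrow> bernoulli_pmf (p (h i) (h j))) (b x) =
            (case x of (i, j) \<Rightarrow> if b (i, j) then p (h i) (h j) else 1 - p (h i) (h j))"
          using ij by (cases "b x") auto
      qed
      finally show ?thesis .
    qed
    ultimately show ?thesis by (intro measurable_cong[THEN iffD2, OF eqn])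
  qed
  then show "(\<lambda>h. emeasure (measure_pmf (graph_given_weights p n h)) A) \<in> borel_measurable (PiM {1..n} (\<lambda>_. W))"
    unfolding eq by (intro borel_measurable_sum measurable_compose[OF _ measurable_ennreal]) auto
qed (auto intro: measure_pmf.subprob_space_axioms)

text \<open>Presence of a cycle is a box event: its own coordinates are forced to be true and all
  others are free, so independence gives a product. Symmetry of \<open>p\<close> undoes the sorting
  of the endpoints.\<close>

lemma prob_cycle:
  assumes h: "h \<in> space (PiM {1..n} (\<lambda>_. W))"
    and vs: "distinct vs" "length vs = k" "set vs \<subseteq> {1..n}" and k: "3 \<le> k"
  shows "emeasure (edge_indicators n h) {b. cycle_edges vs \<subseteq> edges_of n b}
    = (\<Prod>i<k. ennreal (p (h (vs ! i)) (h (vs ! (Suc i mod k)))))"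
proof -
  let ?Q = "cycle_pairs n (cycle_edges vs)"
  let ?q = "\<lambda>x. p (h (fst x)) (h (snd x))"
  have Q: "?Q \<subseteq> vertex_pairs n" by (auto simp: cycle_pairs_def)
  have set: "{b. cycle_edges vs \<subseteq> edges_of n b} = Pi (vertex_pairs n) (\<lambda>x. if x \<in> ?Q then {True} else UNIV)"
    unfolding cycle_subset_edges_of_iff[OF vs k] using Q by (auto simp: Pi_def split: if_splits)
  have "measure (edge_indicators n h) {b. cycle_edges vs \<subseteq> edges_of n b} =
      (\<Prod>x\<in>vertex_pairs n. measure (case x of (i, j) \<Rightarrow> bernoulli_pmf (p (h i) (h j))) (if x \<in> ?Q then {True} else UNIV))"
    unfolding set by (rule measure_Pi_pmf_Pi) simp
  also have "\<dots> = (\<Prod>x\<in>vertex_pairs n. if x \<in> ?Q then ?q x else 1)"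
  proof (rule prod.cong[OF refl])
    fix x assume x: "x \<in> vertex_pairs n"
    obtain i j where ij: "x = (i, j)" by (cases x)
    have "0 \<le> p (h i) (h j)" "p (h i) (h j) \<le> 1"
      using p_component_bounds[OF h, of i j] vertex_pairsD[of i j n] x ij by auto
    then show "measure (case x of (i, j) \<Rightarrow> bernoulli_pmf (p (h i) (h j))) (if x \<in> ?Q then {True} else UNIV) =
        (if x \<in> ?Q then ?q x else 1)"
      using ij by (auto simp: measure_pmf_single)
  qed
  also have "\<dots> = (\<Prod>x\<in>?Q. ?q x)"
    using Q by (simp add: prod.inter_restrict[symmetric] Int_absorb1)
  also have "\<dots> = (\<Prod>i<k. p (h (vs ! i)) (h (vs ! (Suc i mod k))))"
    unfolding prod.reindex_bij_betw[OF bij_betw_cycle_pairs[OF vs k], symmetric]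
    by (intro prod.cong refl) (auto simp: min_def max_def p_sym)
  finally have "emeasure (edge_indicators n h) {b. cycle_edges vs \<subseteq> edges_of n b} =
      ennreal (\<Prod>i<k. p (h (vs ! i)) (h (vs ! (Suc i mod k))))"
    by (simp add: measure_pmf.emeasure_eq_measure)
  also have "\<dots> = (\<Prod>i<k. ennreal (p (h (vs ! i)) (h (vs ! (Suc i mod k)))))"
  proof (rule prod_ennreal[symmetric])
    fix i assume "i \<in> {..<k}"
    then have "vs ! i \<in> {1..n}" "vs ! (Suc i mod k) \<in> {1..n}"
      using vs k by (auto simp: subset_iff)
    then show "0 \<le> p (h (vs ! i)) (h (vs ! (Suc i mod k)))" by (rule p_component_bounds(1)[OF h])
  qed
  finally show ?thesis .
qed

lemma nn_integral_num_cycles_given_weights: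
  assumes "3 \<le> k"
  shows "(\<integral>\<^sup>+E. ennreal (real (num_cycles k E)) \<partial>graph_given_weights p n h)
    = (\<Sum>C\<in>cycles_on k {1..n}. emeasure (edge_indicators n h) {b. C \<subseteq> edges_of n b})"
proof -
  have fin: "finite (cycles_on k {1..n})" by (simp add: finite_cycles_on)
  have "ennreal (real (num_cycles k (edges_of n b))) =
      (\<Sum>C\<in>cycles_on k {1..n}. indicator {b. C \<subseteq> edges_of n b} b)" for b
  proof -
    have "real (num_cycles k (edges_of n b)) = (\<Sum>C\<in>cycles_on k {1..n}. indicator {b. C \<subseteq> edges_of n b} b)"
      using assms fin
      by (subst num_cycles_edges_of) (auto simp: indicator_def sum.If_cases of_bool_def Int_def)
    then show ?thesis by (simp add: sum_ennreal[symmetric] ennreal_indicator)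
  qed
  then show ?thesis
    by (simp add: graph_given_weights_eq nn_integral_sum)
qed

text \<open>All potential cycles are equally likely after averaging, because the weights along any
  list of distinct vertices are again \<open>k\<close> independent copies.\<close>

lemma nn_integral_num_cycles:
  assumes k: "3 \<le> k"
  shows "(\<integral>\<^sup>+E. ennreal (real (num_cycles k E)) \<partial>inhomogeneous_random_graph W p n) =
    of_nat (card (cycles_on k {1..n})) *
    (\<integral>\<^sup>+h. (\<Prod>i<k. ennreal (p (h i) (h (Suc i mod k)))) \<partial>PiM {..<k} (\<lambda>_. W))"
proof -
  let ?I = "\<integral>\<^sup>+h. (\<Prod>i<k. ennreal (p (h i) (h (Suc i mod k)))) \<partial>PiM {..<k} (\<lambda>_. W)"
  have k0: "0 < k" using k by simp
  have K: "(\<lambda>h. measure_pmf (graph_given_weights p n h)) \<in>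
     PiM {1..n} (\<lambda>_. W) \<rightarrow>\<^sub>M subprob_algebra (count_space UNIV)"
    by (rule measurable_graph_given_weights)
  have cyc: "(\<lambda>h. emeasure (edge_indicators n h) {b. C \<subseteq> edges_of n b}) \<in> borel_measurable (PiM {1..n} (\<lambda>_. W)) \<and>
      (\<integral>\<^sup>+h. emeasure (edge_indicators n h) {b. C \<subseteq> edges_of n b} \<partial>PiM {1..n} (\<lambda>_. W)) = ?I"
    if "C \<in> cycles_on k {1..n}" for C
  proof -
    obtain vs where vs: "distinct vs" "length vs = k" "set vs \<subseteq> {1..n}" and C: "C = cycle_edges vs"
      using \<open>C \<in> cycles_on k {1..n}\<close> by (auto simp: cycles_on_def)
    let ?F = "\<lambda>h. \<Prod>i<k. ennreal (p (h i) (h (Suc i mod k)))"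
    let ?T = "\<lambda>h. \<lambda>i\<in>{..<k}. h (vs ! i)"
    have F[measurable]: "?F \<in> borel_measurable (PiM {..<k} (\<lambda>_. W))"
      using k0 by (intro borel_measurable_prod_ennreal measurable_compose[OF _ measurable_ennreal] p_component_measurable) auto
    have T[measurable]: "?T \<in> PiM {1..n} (\<lambda>_. W) \<rightarrow>\<^sub>M PiM {..<k} (\<lambda>_. W)"
    proof (rule measurable_restrict)
      fix i assume "i \<in> {..<k}"
      then have "vs ! i \<in> {1..n}" using vs by (auto simp: subset_iff)
      then show "(\<lambda>h. h (vs ! i)) \<in> PiM {1..n} (\<lambda>_. W) \<rightarrow>\<^sub>M W" by (rule measurable_component_singleton)
    qed
    have FT: "emeasure (edge_indicators n h) {b. C \<subseteq> edges_of n b} = ?F (?T h)"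
      if "h \<in> space (PiM {1..n} (\<lambda>_. W))" for h
      unfolding C prob_cycle[OF that vs k] using k0 by (intro prod.cong) auto
    \<comment> \<open>Indexing into a distinct list is injective, so selecting and renumbering these
      coordinates yields the product law on \<open>{..<k}\<close>.\<close>
    have "distr (PiM {1..n} (\<lambda>_. W)) (PiM {..<k} (\<lambda>_. W)) ?T = PiM {..<k} (\<lambda>_. W)"
      using vs by (intro distr_PiM_reindex) (auto intro: prob_space_axioms inj_on_nth simp: subset_iff)
    then have "?I = (\<integral>\<^sup>+h. ?F h \<partial>distr (PiM {1..n} (\<lambda>_. W)) (PiM {..<k} (\<lambda>_. W)) ?T)"
      by simp
    also have "\<dots> = (\<integral>\<^sup>+h. ?F (?T h) \<partial>PiM {1..n} (\<lambda>_. W))"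
      by (rule nn_integral_distr[OF T]) (simp add: F)
    also have "\<dots> = (\<integral>\<^sup>+h. emeasure (edge_indicators n h) {b. C \<subseteq> edges_of n b} \<partial>PiM {1..n} (\<lambda>_. W))"
      by (intro nn_integral_cong FT[symmetric])
    finally have "(\<integral>\<^sup>+h. emeasure (edge_indicators n h) {b. C \<subseteq> edges_of n b} \<partial>PiM {1..n} (\<lambda>_. W)) = ?I" ..
    moreover have "(\<lambda>h. emeasure (edge_indicators n h) {b. C \<subseteq> edges_of n b}) \<in> borel_measurable (PiM {1..n} (\<lambda>_. W))"
      using measurable_compose[OF T F] by (subst measurable_cong[OF FT])
    ultimately show ?thesis by blast
  qed
  have "(\<integral>\<^sup>+E. ennreal (real (num_cycles k E)) \<partial>inhomogeneous_random_graph W p n) =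
      (\<integral>\<^sup>+h. \<integral>\<^sup>+E. ennreal (real (num_cycles k E)) \<partial>graph_given_weights p n h \<partial>PiM {1..n} (\<lambda>_. W))"
    unfolding inhomogeneous_random_graph_def by (rule nn_integral_bind[OF _ K]) simp
  also have "\<dots> = (\<integral>\<^sup>+h. (\<Sum>C\<in>cycles_on k {1..n}. emeasure (edge_indicators n h) {b. C \<subseteq> edges_of n b}) \<partial>PiM {1..n} (\<lambda>_. W))"
    unfolding nn_integral_num_cycles_given_weights[OF k] ..
  also have "\<dots> = (\<Sum>C\<in>cycles_on k {1..n}. \<integral>\<^sup>+h. emeasure (edge_indicators n h) {b. C \<subseteq> edges_of n b} \<partial>PiM {1..n} (\<lambda>_. W))"
    using cyc by (intro nn_integral_sum) blast
  also have "\<dots> = (\<Sum>C\<in>cycles_on k {1..n}. ?I)"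
    using cyc by (intro sum.cong refl) blast
  finally show ?thesis by simp
qed

lemma integral_num_cycles:
  assumes "3 \<le> k"
  shows "(\<integral>E. real (num_cycles k E) \<partial>inhomogeneous_random_graph W p n) =
    real (card (cycles_on k {1..n})) *
    enn2real (\<integral>\<^sup>+h. (\<Prod>i<k. ennreal (p (h i) (h (Suc i mod k)))) \<partial>PiM {..<k} (\<lambda>_. W))"
proof -
  \<comment> \<open>A nonempty weight space ensures that the mixture carries the discrete
    sigma-algebra on graphs, for which every function is measurable.\<close>
  have "space (PiM {1..n} (\<lambda>_. W)) \<noteq> {}"
    by (rule prob_space.not_empty) (intro prob_space_PiM prob_space_axioms)
  then have "sets (inhomogeneous_random_graph W p n) = sets (count_space UNIV)"
    unfolding inhomogeneous_random_graph_def
    by (intro sets_bind) (use measurable_graph_given_weights[of n] in auto)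
  then have "borel_measurable (inhomogeneous_random_graph W p n) =
      (borel_measurable (count_space UNIV) :: (nat set set \<Rightarrow> real) set)"
    by (rule measurable_cong_sets[OF _ refl])
  then have "(\<lambda>E. real (num_cycles k E)) \<in> borel_measurable (inhomogeneous_random_graph W p n)"
    by simp
  then have "(\<integral>E. real (num_cycles k E) \<partial>inhomogeneous_random_graph W p n) =
      enn2real (\<integral>\<^sup>+E. ennreal (real (num_cycles k E)) \<partial>inhomogeneous_random_graph W p n)"
    by (rule integral_eq_nn_integral) simp
  then show ?thesis
    unfolding nn_integral_num_cycles[OF assms]
    by (simp only: enn2real_mult ennreal_of_nat_eq_real_of_nat enn2real_ennreal of_nat_0_le_iff)
qed

end

section \<open>Cycle counts for the power-law weights\<close>

lemma gamma_scale_pos: "2 < \<tau> \<Longrightarrow> 0 < n \<Longrightarrow> 0 < gamma_scale \<tau> n"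
  by (simp add: gamma_scale_def)

lemma ln_gamma_scale_at_top:
  assumes "2 < \<tau>"
  shows "filterlim (\<lambda>n. ln (gamma_scale \<tau> n)) at_top sequentially"
proof -
  have "filterlim (\<lambda>n. real n * ((\<tau> - 1) / (\<tau> - 2))) at_top sequentially"
    using assms by (intro filterlim_at_top_mult_tendsto_pos[OF tendsto_const] filterlim_real_sequentially) auto
  then show ?thesis
    unfolding gamma_scale_def
    by (intro filterlim_compose[OF ln_at_top] filterlim_compose[OF sqrt_at_top])
qed

context connection_function
begin

lemma edge_kernel: "edge_kernel (weight_law \<tau>) (connection_prob \<tau> f n)"
proof -
  interpret W: prob_space "weight_law \<tau>" using tau by (intro prob_space_weight_law) simp
  show ?thesis
  proof
    fix x y :: real assume "x \<in> space (weight_law \<tau>)" "y \<in> space (weight_law \<tau>)"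
    then have "0 \<le> x * y / (gamma_scale \<tau> n)\<^sup>2" by simp
    then show "0 \<le> connection_prob \<tau> f n x y \<and> connection_prob \<tau> f n x y \<le> 1"
      unfolding connection_prob_def using nonneg le_1 by blast
  next
    show "connection_prob \<tau> f n x y = connection_prob \<tau> f n y x" for x y
      by (simp add: connection_prob_def mult.commute)
  next
    have id_meas: "(\<lambda>x. x) \<in> weight_law \<tau> \<rightarrow>\<^sub>M borel"
      unfolding measurable_cong_sets[OF sets_weight_law refl] by (simp add: measurable_restrict_space1)
    have "(\<lambda>z. f (max 0 (fst z * snd z / (gamma_scale \<tau> n)\<^sup>2))) \<in> borel_measurable (weight_law \<tau> \<Otimes>\<^sub>M weight_law \<tau>)"
      by (intro measurable_compose[OF _ measurable_extension] borel_measurable_divide borel_measurable_times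
          borel_measurable_const measurable_compose[OF measurable_fst id_meas] measurable_compose[OF measurable_snd id_meas])
    moreover have "(case z of (x, y) \<Rightarrow> connection_prob \<tau> f n x y) = f (max 0 (fst z * snd z / (gamma_scale \<tau> n)\<^sup>2))"
      if "z \<in> space (weight_law \<tau> \<Otimes>\<^sub>M weight_law \<tau>)" for z
      using that by (auto simp: space_pair_measure connection_prob_def max_def)
    ultimately show "(\<lambda>(x, y). connection_prob \<tau> f n x y) \<in> borel_measurable (weight_law \<tau> \<Otimes>\<^sub>M weight_law \<tau>)"
      by (subst measurable_cong)
  qed
qed

text \<open>An exact identity for every \<open>n \<ge> k\<close>; all asymptotics is left to
  \<open>cycle_integral\<close>.\<close>

lemma mean_cycles_eq:
  assumes "3 \<le> k" "k \<le> n"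
  shows "mean_cycles \<tau> f k n = real (n choose k) * fact k / (2 * real k) *
    ((\<tau> - 1) ^ k * gamma_scale \<tau> n powr (real k * (1 - \<tau>))) *
    enn2real (cycle_integral (log_kernel \<tau> f) k (ln (gamma_scale \<tau> n)))"
proof -
  interpret edge_kernel "weight_law \<tau>" "connection_prob \<tau> f n" by (rule edge_kernel)
  have \<gamma>: "0 < gamma_scale \<tau> n" using assms tau by (intro gamma_scale_pos) auto
  have "2 * k * card (cycles_on k {1..n}) = (n choose k) * fact k"
    using card_cycles_on[of "{1..n}" k] assms by simp
  then have "real (2 * k * card (cycles_on k {1..n})) = real ((n choose k) * fact k)" by simp
  then have card: "real (card (cycles_on k {1..n})) = real (n choose k) * fact k / (2 * real k)"
    using assms by (simp add: field_simps)
  have "(\<integral>\<^sup>+h. (\<Prod>i<k. ennreal (connection_prob \<tau> f n (h i) (h (Suc i mod k)))) \<partial>PiM {..<k} (\<lambda>_. weight_law \<tau>)) =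
      ennreal (((\<tau> - 1) * gamma_scale \<tau> n powr (1 - \<tau>)) ^ k) * cycle_integral (log_kernel \<tau> f) k (ln (gamma_scale \<tau> n))"
    unfolding connection_prob_def cycle_integral_def
    using tau \<gamma> assms nonneg by (intro nn_integral_cycle_weights measurable_extension) auto
  moreover have "((\<tau> - 1) * gamma_scale \<tau> n powr (1 - \<tau>)) ^ k = (\<tau> - 1) ^ k * gamma_scale \<tau> n powr (real k * (1 - \<tau>))"
    using \<gamma> by (simp add: power_mult_distrib powr_power mult.commute)
  ultimately show ?thesis
    unfolding mean_cycles_def integral_num_cycles[OF assms(1)] card
    using tau by (simp add: enn2real_mult)
qed

lemma cycle_integral_normalised_tendsto:
  assumes "even k" "4 \<le> k"
  shows "(\<lambda>n. enn2real (cycle_integral (log_kernel \<tau> f) k (ln (gamma_scale \<tau> n))) / (2 * ln (gamma_scale \<tau> n)))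
    \<longlonglongrightarrow> (LBINT v. cmod (J_integral \<tau> f v) ^ k)"
proof -
  let ?g = "log_kernel \<tau> f" and ?L = "\<lambda>n. ln (gamma_scale \<tau> n)"
  have L: "filterlim ?L at_top sequentially" using tau by (intro ln_gamma_scale_at_top) simp
  have k: "k = Suc (Suc (k - 2))" "Suc (k - 2) = k - 1" using assms by auto
  have "(\<lambda>n. cycle_integral ?g k (?L n) / ennreal (2 * ?L n)) \<longlonglongrightarrow> ennreal (iterated_convolution ?g ?g (Suc (k - 2)) 0)"
    by (rule cycle_integral_asymptotics[OF bounded_density_log_kernel bounded_density_weighted_log_kernel assms(1) k(1) L])
  \<comment> \<open>The limit is finite, so convergence passes from the extended nonnegative reals
    to the reals.\<close>
  then have lim: "(\<lambda>n. enn2real (cycle_integral ?g k (?L n) / ennreal (2 * ?L n))) \<longlonglongrightarrow> iterated_convolution ?g ?g (k - 1) 0"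
    unfolding k(2) by (rule tendsto_enn2real) (simp add: less_imp_le[OF iterated_convolution_pos])
  have "eventually (\<lambda>n. 0 < ?L n) sequentially"
    using L by (simp add: filterlim_at_top_dense)
  then have "eventually (\<lambda>n. enn2real (cycle_integral ?g k (?L n) / ennreal (2 * ?L n)) =
      enn2real (cycle_integral ?g k (?L n)) / (2 * ?L n)) sequentially"
  proof eventually_elim
    case (elim n)
    have "cycle_integral ?g k (?L n) = ennreal (2 * ?L n) * (cycle_integral ?g k (?L n) / ennreal (2 * ?L n))"
      using elim by (subst mult.commute) (simp add: ennreal_divide_times mult_divide_eq_ennreal)
    from arg_cong[OF this, of enn2real]
    have "enn2real (cycle_integral ?g k (?L n)) = (2 * ?L n) * enn2real (cycle_integral ?g k (?L n) / ennreal (2 * ?L n))"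
      using elim by (simp only: enn2real_mult) simp
    then show ?case using elim by (simp add: field_simps)
  qed
  then have "(\<lambda>n. enn2real (cycle_integral ?g k (?L n)) / (2 * ?L n)) \<longlonglongrightarrow> iterated_convolution ?g ?g (k - 1) 0"
    by (rule Lim_transform_eventually[OF lim])
  then show ?thesis using integral_J_power[OF assms(1)] assms(2) by simp
qed

lemma integral_J_power_pos:
  assumes "even k" "4 \<le> k"
  shows "0 < (LBINT v. cmod (J_integral \<tau> f v) ^ k)"
  using integral_J_power[OF assms(1)] assms(2) iterated_convolution_pos by simp

end

theorem theorem3p9:
  fixes \<tau> :: real and f :: "real \<Rightarrow> real" and k :: nat
  assumes "2 < \<tau>" and "\<tau> < 3"
    and "continuous_on {0..} f"
    and "mono_on {0..} f"
    and "\<And>x. 0 \<le> x \<Longrightarrow> 0 \<le> f x"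
    and "((\<lambda>x. f x / x) \<longlongrightarrow> 1) (at_right 0)"
    and "(f \<longlongrightarrow> 1) at_top"
    and "even k" and "4 \<le> k"
  shows "(\<lambda>n. mean_cycles \<tau> f k n) \<sim>[sequentially]
         (\<lambda>n. (gamma_scale \<tau> n powr (real k * (1 - \<tau>)) * ln (gamma_scale \<tau> n))
              * (\<tau> - 1) ^ k * (1 / real k) * real (n choose k) * fact k
              * (LBINT v. (cmod (J_integral \<tau> f v)) ^ k))"
proof -
  interpret connection_function \<tau> f
    by standard (use assms in auto)
  let ?L = "\<lambda>n. ln (gamma_scale \<tau> n)"
  define K where "K = (LBINT v. cmod (J_integral \<tau> f v) ^ k)"
  \<comment> \<open>The 2 in the cycle count \<open>1 / (2 * k)\<close> cancels against the one in
    the denominator of \<open>x\<close>, leaving \<open>1 / k\<close>.\<close>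
  define T where "T n = (gamma_scale \<tau> n powr (real k * (1 - \<tau>)) * ?L n)
    * (\<tau> - 1) ^ k * (1 / real k) * real (n choose k) * fact k" for n
  define x where "x n = enn2real (cycle_integral (log_kernel \<tau> f) k (?L n)) / (2 * ?L n)" for n
  have "x \<longlonglongrightarrow> K"
    unfolding x_def K_def using assms(8,9) by (rule cycle_integral_normalised_tendsto)
  \<comment> \<open>Convergence to a constant is an asymptotic equivalence only if the constant is
    nonzero.\<close>
  moreover have "K \<noteq> 0" using integral_J_power_pos[OF assms(8,9)] by (simp add: K_def)
  ultimately have "x \<sim>[sequentially] (\<lambda>_. K)" by (rule tendsto_imp_asymp_equiv_const)
  then have "(\<lambda>n. T n * x n) \<sim>[sequentially] (\<lambda>n. T n * K)"
    by (intro asymp_equiv_intros)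
  moreover have "eventually (\<lambda>n. T n * x n = mean_cycles \<tau> f k n) sequentially"
  proof -
    have "eventually (\<lambda>n. 0 < ?L n) sequentially"
      using ln_gamma_scale_at_top[OF assms(1)] by (simp add: filterlim_at_top_dense)
    with eventually_ge_at_top[of k] show ?thesis
    proof eventually_elim
      case (elim n)
      then show ?case
        using assms(9) by (simp add: mean_cycles_eq T_def x_def field_simps)
    qed
  qed
  ultimately have "(\<lambda>n. mean_cycles \<tau> f k n) \<sim>[sequentially] (\<lambda>n. T n * K)"
    by (rule asymp_equiv_transfer) simp
  then show ?thesis unfolding T_def K_def .
qed

end
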